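(* Let $\tau>0$ and let $\delta,p:\mathbb{R}\to\mathbb{R}$ be positive almost automorphic functions such that the mean of $\delta$ satisfies $M(\delta)>\delta_->0$ for some constant $\delta_-$. Then for $\gamma>0$ small enough (depending on the given data $\delta,p,\tau$), the delayed Lasota-Wazewska model $$y'(t)=-\delta(t)y(t)+p(t)e^{-\gamma y(t-\tau)},\qquad t\ge0,$$ has a unique asymptotically stable almost automorphic solution.
   Context: A continuous function $\psi:\mathbb{R}\to\mathbb{R}$ is almost automorphic if every real sequence has a subsequence $\{\tau_n\}$ for which $\tilde\psi(t)=\lim_n\psi(t+\tau_n)$ and $\psi(t)=\lim_n\tilde\psi(t-\tau_n)$ (pointwise) for all $t\in\mathbb{R}$. A bounded continuous function $h$ is ergodic if the limit $M(h)=\lim_{T\to\infty}\frac1{2T}\int_{-T+\xi}^{T+\xi}h(s)\,ds$ exists uniformly with respect to $\xi\in\mathbb{R}$ and is independent of $\xi$; $M(h)$ is its mean. The hypothesis on $M(\delta)$ includes that $\delta$ is ergodic. *)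

theory Defs
  imports "HOL-Analysis.Analysis"
begin

definition almost_automorphic :: "(real \<Rightarrow> real) \<Rightarrow> bool" where
  "almost_automorphic \<psi> \<longleftrightarrow> continuous_on UNIV \<psi> \<and>
     (\<forall>s :: nat \<Rightarrow> real. \<exists>r. strict_mono r \<and>
        (\<exists>\<psi>'. (\<forall>t. (\<lambda>n. \<psi> (t + s (r n))) \<longlonglongrightarrow> \<psi>' t) \<and>
              (\<forall>t. (\<lambda>n. \<psi>' (t - s (r n))) \<longlonglongrightarrow> \<psi> t)))"

text \<open>The limit \<open>m\<close> does not depend on the shift \<open>\<xi>\<close>, and the
  convergence as \<open>T\<close> tends to infinity is uniform in \<open>\<xi>\<close>.\<close>

definition has_mean :: "(real \<Rightarrow> real) \<Rightarrow> real \<Rightarrow> bool" where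
  "has_mean h m \<longleftrightarrow>
     uniform_limit UNIV (\<lambda>T \<xi>. 1 / (2 * T) * integral {- T + \<xi>..T + \<xi>} h) (\<lambda>\<xi>. m) at_top"

definition ergodic :: "(real \<Rightarrow> real) \<Rightarrow> bool" where
  "ergodic h \<longleftrightarrow> bounded (range h) \<and> continuous_on UNIV h \<and> (\<exists>m. has_mean h m)"

definition mean :: "(real \<Rightarrow> real) \<Rightarrow> real" where
  "mean h = (THE m. has_mean h m)"

text \<open>Solutions on \<open>[t0 - \<tau>, \<infinity>)\<close> of \<open>y'(t) = F t (y t) (y (t - \<tau>))\<close>, \<open>t \<ge> t0\<close>.
  At \<open>t = t0\<close> the derivative is the right one; at \<open>t > t0\<close> it is the usual two-sided one.\<close>

definition dde_solution ::
    "(real \<Rightarrow> real \<Rightarrow> real \<Rightarrow> real) \<Rightarrow> real \<Rightarrow> real \<Rightarrow> (real \<Rightarrow> real) \<Rightarrow> bool" where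
  "dde_solution F \<tau> t0 y \<longleftrightarrow> continuous_on {t0 - \<tau>..} y \<and>
     (\<forall>t\<ge>t0. (y has_real_derivative F t (y t) (y (t - \<tau>))) (at t within {t0..}))"

text \<open>Lyapunov stability and local attractivity in the phase space of continuous functions
  on \<open>[t0 - \<tau>, t0]\<close> with the supremum norm, for every initial time \<open>t0 \<ge> 0\<close>.\<close>

definition dde_stable ::
    "(real \<Rightarrow> real \<Rightarrow> real \<Rightarrow> real) \<Rightarrow> real \<Rightarrow> (real \<Rightarrow> real) \<Rightarrow> bool" where
  "dde_stable F \<tau> y \<longleftrightarrow>
     (\<forall>t0\<ge>0. \<forall>\<epsilon>>0. \<exists>\<eta>>0. \<forall>z. dde_solution F \<tau> t0 z \<longrightarrow>
        (\<forall>s\<in>{t0 - \<tau>..t0}. \<bar>z s - y s\<bar> < \<eta>) \<longrightarrow> (\<forall>t\<ge>t0. \<bar>z t - y t\<bar> < \<epsilon>))"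

definition dde_attractive ::
    "(real \<Rightarrow> real \<Rightarrow> real \<Rightarrow> real) \<Rightarrow> real \<Rightarrow> (real \<Rightarrow> real) \<Rightarrow> bool" where
  "dde_attractive F \<tau> y \<longleftrightarrow>
     (\<forall>t0\<ge>0. \<exists>\<eta>>0. \<forall>z. dde_solution F \<tau> t0 z \<longrightarrow>
        (\<forall>s\<in>{t0 - \<tau>..t0}. \<bar>z s - y s\<bar> < \<eta>) \<longrightarrow> ((\<lambda>t. z t - y t) \<longlongrightarrow> 0) at_top)"

definition dde_asymptotically_stable ::
    "(real \<Rightarrow> real \<Rightarrow> real \<Rightarrow> real) \<Rightarrow> real \<Rightarrow> (real \<Rightarrow> real) \<Rightarrow> bool" where
  "dde_asymptotically_stable F \<tau> y \<longleftrightarrow> dde_stable F \<tau> y \<and> dde_attractive F \<tau> y"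

definition lasota_wazewska ::
    "(real \<Rightarrow> real) \<Rightarrow> (real \<Rightarrow> real) \<Rightarrow> real \<Rightarrow> real \<Rightarrow> real \<Rightarrow> real \<Rightarrow> real" where
  "lasota_wazewska \<delta> p \<gamma> t u v = - \<delta> t * u + p t * exp (- \<gamma> * v)"

end

theory Submission
  imports Defs
begin

text \<open>
  The almost automorphic solution is the fixed point of
  \<open>y \<mapsto> (\<lambda>t. \<integral>\<^sub>0\<^sup>\<infinity> exp (- \<integral>\<^bsub>t-r\<^esub>\<^sup>t \<delta>) p (t - r) exp (- \<gamma> y (t - r - \<tau>)) dr)\<close>. The mean condition gives
  \<open>\<integral>\<^sub>s\<^sup>t \<delta> \<ge> a (t - s) - c\<close>, so for small \<open>\<gamma>\<close> this map contracts by a factor \<open>1/2\<close> on bounded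
  nonnegative functions. By dominated convergence the fixed point depends continuously on \<open>(\<delta>, p)\<close>
  under pointwise convergence, even when the limits are merely measurable, and it commutes with
  translations of \<open>(\<delta>, p)\<close>; hence it inherits both continuity and almost automorphy from the coefficients.

  The same exponential decay makes the difference of two solutions that are bounded below by \<open>-1\<close>
  tend to \<open>0\<close>. An almost automorphic solution is asymptotically nonnegative, hence nonnegative,
  and two almost automorphic functions whose difference vanishes at \<open>\<infinity>\<close> agree.
\<close>

section \<open>Almost automorphic functions\<close>

text \<open>If \<open>\<bar>\<psi> (s n)\<bar>\<close> exceeded \<open>n\<close> for every
  \<open>n\<close>, no subsequence of \<open>\<psi> (s n)\<close> could converge, contrary to the
  definition at \<open>t = 0\<close>.\<close>

lemma almost_automorphic_bounded:
  assumes "almost_automorphic \<psi>"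
  obtains B where "\<And>t. \<bar>\<psi> t\<bar> \<le> B"
proof -
  have "\<exists>B. \<forall>t. \<bar>\<psi> t\<bar> \<le> B"
  proof (rule ccontr)
    assume "\<not> ?thesis"
    then have "\<forall>n. \<exists>t. real n < \<bar>\<psi> t\<bar>"
      by (meson not_le)
    then obtain s where s: "\<And>n. real n < \<bar>\<psi> (s n)\<bar>"
      by metis
    obtain r and \<psi>' :: "real \<Rightarrow> real" where r: "strict_mono r"
      and lim: "(\<lambda>n. \<psi> (0 + s (r n))) \<longlonglongrightarrow> \<psi>' 0"
      using assms unfolding almost_automorphic_def by meson
    from lim obtain K where K: "\<And>n. \<bar>\<psi> (s (r n))\<bar> \<le> K"
      using convergent_imp_Bseq[of "\<lambda>n. \<psi> (s (r n))"] by (auto simp: convergent_def Bseq_def)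
    obtain n where "K < real n"
      using reals_Archimedean2 by blast
    moreover have "real n \<le> real (r n)"
      using seq_suble[OF r, of n] by simp
    ultimately show False
      using s[of "r n"] K[of n] by linarith
  qed
  then show ?thesis using that by blast
qed

text \<open>The extraction for \<open>g\<close> is applied to the sequence already thinned out for
  \<open>f\<close>, whose limits survive. This lets two functions be shifted along one
  sequence.\<close>

lemma almost_automorphic_common_subseq:
  assumes "almost_automorphic f" "almost_automorphic g"
  obtains r f' g' where "strict_mono (r :: nat \<Rightarrow> nat)"
    "\<And>t. (\<lambda>n. f (t + s (r n))) \<longlonglongrightarrow> f' t" "\<And>t. (\<lambda>n. f' (t - s (r n))) \<longlonglongrightarrow> f t"
    "\<And>t. (\<lambda>n. g (t + s (r n))) \<longlonglongrightarrow> g' t" "\<And>t. (\<lambda>n. g' (t - s (r n))) \<longlonglongrightarrow> g t"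
proof -
  obtain r1 f' where r1: "strict_mono r1" and f: "\<And>t. (\<lambda>n. f (t + s (r1 n))) \<longlonglongrightarrow> f' t"
    "\<And>t. (\<lambda>n. f' (t - s (r1 n))) \<longlonglongrightarrow> f t"
    using assms(1) unfolding almost_automorphic_def by blast
  obtain r2 g' where r2: "strict_mono r2" and g: "\<And>t. (\<lambda>n. g (t + (s \<circ> r1) (r2 n))) \<longlonglongrightarrow> g' t"
    "\<And>t. (\<lambda>n. g' (t - (s \<circ> r1) (r2 n))) \<longlonglongrightarrow> g t"
    using assms(2) unfolding almost_automorphic_def by meson
  show ?thesis
    by (rule that[of "r1 \<circ> r2"])
      (use strict_mono_o[OF r1 r2] g LIMSEQ_subseq_LIMSEQ[OF f(1) r2] LIMSEQ_subseq_LIMSEQ[OF f(2) r2]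
        in \<open>auto simp: o_def\<close>)
qed

text \<open>An almost automorphic function is recovered from its values near \<open>\<infinity>\<close>,
  by applying the definition to the shifts by \<open>n\<close>.\<close>

lemma almost_automorphic_le_if_asymptotically_le:
  assumes "almost_automorphic f" "almost_automorphic g"
    and "\<And>e. 0 < e \<Longrightarrow> \<forall>\<^sub>F t in at_top. f t \<le> g t + e"
  shows "f t \<le> g t"
proof -
  obtain r f' g' where r: "strict_mono r"
    and f: "\<And>t. (\<lambda>n. f (t + real (r n))) \<longlonglongrightarrow> f' t" "\<And>t. (\<lambda>n. f' (t - real (r n))) \<longlonglongrightarrow> f t"
    and g: "\<And>t. (\<lambda>n. g (t + real (r n))) \<longlonglongrightarrow> g' t" "\<And>t. (\<lambda>n. g' (t - real (r n))) \<longlonglongrightarrow> g t"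
    using almost_automorphic_common_subseq[OF assms(1,2)] by metis
  have r_top: "filterlim (\<lambda>n. t + real (r n)) at_top sequentially" for t
    by (intro filterlim_tendsto_add_at_top[OF tendsto_const]
        filterlim_compose[OF filterlim_real_sequentially] filterlim_subseq r)
  have "f' t \<le> g' t + e" if "0 < e" for t e
  proof (rule tendsto_le[OF sequentially_bot])
    show "(\<lambda>n. g (t + real (r n)) + e) \<longlonglongrightarrow> g' t + e"
      by (intro tendsto_intros g)
    show "\<forall>\<^sub>F n in sequentially. f (t + real (r n)) \<le> g (t + real (r n)) + e"
      using r_top assms(3)[OF that] by (auto simp: filterlim_iff)
  qed (rule f)
  then have "f' t \<le> g' t" for t
    by (rule field_le_epsilon)
  then show ?thesis
    by (intro LIMSEQ_le[OF f(2) g(2)]) auto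
qed

lemma almost_automorphic_zero: "almost_automorphic (\<lambda>t. 0)"
  unfolding almost_automorphic_def
  by (auto intro!: exI[of _ id] exI[of _ "\<lambda>t. 0 :: real"] simp: strict_mono_def)

section \<open>Convolution with an exponentially decaying kernel\<close>

text \<open>Measurability replaces continuity because limits of translates of an almost automorphic
  function may be discontinuous and must stay in the class. The last clause bounds from below the
  integral of \<delta> over \<open>{t - r..t}\<close>, written in reflected form.\<close>

definition decaying :: "real \<Rightarrow> real \<Rightarrow> real \<Rightarrow> (real \<Rightarrow> real) \<Rightarrow> bool" where
  "decaying D a c \<delta> \<longleftrightarrow> 0 < a \<and> \<delta> \<in> borel_measurable borel \<and> (\<forall>t. 0 \<le> \<delta> t \<and> \<delta> t \<le> D) \<and>
     (\<forall>t. \<forall>r\<ge>0. a * r - c \<le> (LBINT v:{0..r}. \<delta> (t - v)))"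

text \<open>The propagator of \<open>y' = - \<delta> y\<close> from time \<open>t - r\<close> to
  time \<open>t\<close>. Using the elapsed time \<open>r\<close> as variable makes translations act
  on \<delta> alone.\<close>

definition decay_kernel :: "(real \<Rightarrow> real) \<Rightarrow> real \<Rightarrow> real \<Rightarrow> real" where
  "decay_kernel \<delta> t r = exp (- (LBINT v:{0..r}. \<delta> (t - v)))"

text \<open>Variation of constants started at minus infinity: for decaying continuous \<delta> and
  bounded continuous \<open>g\<close> it is a bounded solution of
  \<open>y' = - \<delta> y + g\<close> on the whole line.\<close>

definition decay_conv :: "(real \<Rightarrow> real) \<Rightarrow> (real \<Rightarrow> real) \<Rightarrow> real \<Rightarrow> real" where
  "decay_conv \<delta> g t = (LBINT r:{0..}. decay_kernel \<delta> t r * g (t - r))"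

lemma decay_kernel_measurable [measurable]:
  assumes [measurable]: "\<delta> \<in> borel_measurable borel"
  shows "(\<lambda>(t, r). decay_kernel \<delta> t r) \<in> borel_measurable (borel \<Otimes>\<^sub>M borel)"
proof -
  have "(\<lambda>x. LINT v|lborel. indicator {0..snd x} v * \<delta> (fst x - v)) \<in> borel_measurable (borel \<Otimes>\<^sub>M borel)"
    \<comment> \<open>Expressed by inequalities between \<open>v\<close> and \<open>snd x\<close>,
      the interval with moving endpoint is jointly measurable.\<close>
    unfolding indicator_def atLeastAtMost_iff by measurable
  then show ?thesis
    unfolding decay_kernel_def set_lebesgue_integral_def by (simp add: case_prod_beta')
qed

lemma decay_conv_measurable [measurable]:
  assumes [measurable]: "\<delta> \<in> borel_measurable borel" "g \<in> borel_measurable borel"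
  shows "decay_conv \<delta> g \<in> borel_measurable borel"
proof -
  have "(\<lambda>t. LINT r|lborel. indicator {0..} r * (decay_kernel \<delta> t r * g (t - r))) \<in> borel_measurable borel"
    by measurable
  then show ?thesis
    unfolding decay_conv_def[abs_def] set_lebesgue_integral_def by simp
qed

section \<open>Integrability and dominated convergence on the real line\<close>

lemma set_integrable_bounded_interval:
  fixes f :: "real \<Rightarrow> real"
  assumes "f \<in> borel_measurable borel" "\<And>x. \<bar>f x\<bar> \<le> B"
  shows "set_integrable lborel {a..b} f"
proof -
  have *: "set_integrable lborel {a..b} (\<lambda>x. B)"
    unfolding set_integrable_def
    by (intro integrable_scaleR_left integrable_real_indicator) (auto simp: emeasure_lborel_Icc_eq)
  show ?thesis
    by (rule set_integrable_bound[OF *])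
     (use assms in \<open>auto simp: set_borel_measurable_def intro!: order_trans[OF _ abs_ge_self]\<close>)
qed

text \<open>The value is known for the gauge integral. Nonnegativity of the integrand gives absolute
  integrability, and Borel measurability brings this down from the completed measure to
  \<open>lborel\<close>.\<close>

lemma exp_decay_integral:
  fixes a :: real
  assumes "0 < a"
  shows "set_integrable lborel {0..} (\<lambda>r. exp (c - a * r))"
    and "(LBINT r:{0..}. exp (c - a * r)) = exp c / a"
proof -
  have "((\<lambda>r. exp c * exp (- a * r)) has_integral exp c * (exp (- a * 0) / a)) {0..}"
    using has_integral_exp_minus_to_infinity[OF assms, of 0] by (rule has_integral_mult_right)
  then have I: "((\<lambda>r. exp (c - a * r)) has_integral exp c / a) {0..}"
    by (simp add: exp_diff exp_minus field_simps)
  then have "(\<lambda>r. exp (c - a * r)) absolutely_integrable_on {0..}"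
    by (intro nonnegative_absolutely_integrable_1) auto
  then show *: "set_integrable lborel {0..} (\<lambda>r. exp (c - a * r))"
    unfolding set_integrable_def by (subst (asm) integrable_completion) auto
  show "(LBINT r:{0..}. exp (c - a * r)) = exp c / a"
    using set_borel_integral_eq_integral(2)[OF *] I by (simp add: integral_unique)
qed

text \<open>Cutting off with the indicator of \<open>S\<close> turns convergence on \<open>S\<close>
  into convergence on the whole line, which also yields measurability of the limit.\<close>

lemma set_integral_dominated_convergence_real:
  fixes f :: "nat \<Rightarrow> real \<Rightarrow> real"
  assumes "set_integrable lborel S w" "S \<in> sets borel"
    and "\<And>n. f n \<in> borel_measurable borel"
    and "\<And>x. x \<in> S \<Longrightarrow> (\<lambda>n. f n x) \<longlonglongrightarrow> g x"
    and "\<And>n x. x \<in> S \<Longrightarrow> \<bar>f n x\<bar> \<le> w x"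
  shows "(\<lambda>n. LBINT x:S. f n x) \<longlonglongrightarrow> (LBINT x:S. g x)"
proof -
  note [measurable] = assms(2,3)
  have lim: "(\<lambda>n. indicator S x *\<^sub>R f n x) \<longlonglongrightarrow> indicator S x *\<^sub>R g x" for x
    using assms(4) by (auto simp: indicator_def)
  have f: "(\<lambda>x. indicator S x *\<^sub>R f n x) \<in> borel_measurable lborel" for n
    by measurable
  show ?thesis
    unfolding set_lebesgue_integral_def
  proof (rule integral_dominated_convergence[where w = "\<lambda>x. indicator S x *\<^sub>R w x"])
    show "(\<lambda>x. indicator S x *\<^sub>R g x) \<in> borel_measurable lborel"
      by (rule borel_measurable_LIMSEQ_real[OF lim f])
  qed (use assms(1,5) lim f in \<open>auto simp: set_integrable_def indicator_def\<close>)
qed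

section \<open>Decaying rates: closure properties and estimates for the convolution\<close>

lemma decayingD:
  assumes "decaying D a c \<delta>"
  shows "0 < a" "\<delta> \<in> borel_measurable borel" "0 \<le> \<delta> t" "\<delta> t \<le> D" "\<bar>\<delta> t\<bar> \<le> D"
    "0 \<le> r \<Longrightarrow> a * r - c \<le> (LBINT v:{0..r}. \<delta> (t - v))"
  using assms by (auto simp: decaying_def)

lemma decaying_translate:
  assumes "decaying D a c \<delta>"
  shows "decaying D a c (\<lambda>t. \<delta> (t + s))"
proof -
  note [measurable] = decayingD(2)[OF assms]
  have "(\<lambda>t. \<delta> (t + s)) \<in> borel_measurable borel"
    by measurable
  moreover have "a * r - c \<le> (LBINT v:{0..r}. \<delta> (t - v + s))" if "0 \<le> r" for t r
    using decayingD(6)[OF assms that, of "t + s"] by (simp add: algebra_simps)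
  ultimately show ?thesis
    using decayingD[OF assms] unfolding decaying_def by simp
qed

lemma tendsto_interval_integral:
  assumes "\<And>n. decaying D a c (\<delta> n)" "\<And>t. (\<lambda>n. \<delta> n t) \<longlonglongrightarrow> \<delta>' t"
  shows "(\<lambda>n. LBINT v:{0..r}. \<delta> n (t - v)) \<longlonglongrightarrow> (LBINT v:{0..r}. \<delta>' (t - v))"
proof (rule set_integral_dominated_convergence_real[where w = "\<lambda>_. D"])
  show "set_integrable lborel {0..r} (\<lambda>_. D)"
    by (rule set_integrable_bounded_interval[where B = "\<bar>D\<bar>"]) auto
  fix n
  note [measurable] = decayingD(2)[OF assms(1)]
  show "(\<lambda>v. \<delta> n (t - v)) \<in> borel_measurable borel"
    by measurable
qed (use assms decayingD(5)[OF assms(1)] in auto)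

text \<open>The clauses on \<delta> are measurability and non-strict bounds, which survive pointwise
  limits; the integral clause does so by dominated convergence with the constant \<open>D\<close> as
  majorant.\<close>

lemma decaying_lim:
  assumes "\<And>n. decaying D a c (\<delta> n)" "\<And>t. (\<lambda>n. \<delta> n t) \<longlonglongrightarrow> \<delta>' t"
  shows "decaying D a c \<delta>'"
  unfolding decaying_def
proof (intro conjI allI impI)
  show "\<delta>' \<in> borel_measurable borel"
    by (rule borel_measurable_LIMSEQ_real[OF assms(2) decayingD(2)[OF assms(1)]])
  show "0 \<le> \<delta>' t" for t
    by (rule LIMSEQ_le_const[OF assms(2)]) (use decayingD(3)[OF assms(1)] in auto)
  show "\<delta>' t \<le> D" for t
    by (rule LIMSEQ_le_const2[OF assms(2)]) (use decayingD(4)[OF assms(1)] in auto)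
  show "a * r - c \<le> (LBINT v:{0..r}. \<delta>' (t - v))" if "0 \<le> r" for t r
    by (rule LIMSEQ_le_const[OF tendsto_interval_integral[OF assms]])
      (use decayingD(6)[OF assms(1) that] in auto)
qed (use decayingD(1)[OF assms(1)] in auto)

lemma decay_kernel_pos: "0 < decay_kernel \<delta> t r"
  by (simp add: decay_kernel_def)

lemma decay_kernel_le:
  assumes "decaying D a c \<delta>" "0 \<le> r"
  shows "decay_kernel \<delta> t r \<le> exp (c - a * r)"
  using decayingD(6)[OF assms] by (auto simp: decay_kernel_def algebra_simps)

lemma abs_decay_kernel_mult_le:
  assumes "decaying D a c \<delta>" "0 \<le> r" "\<bar>x\<bar> \<le> G"
  shows "\<bar>decay_kernel \<delta> t r * x\<bar> \<le> exp (c - a * r) * G"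
  unfolding abs_mult using decay_kernel_le[OF assms(1,2), of t] decay_kernel_pos[of \<delta> t r] assms(3)
  by (intro mult_mono) auto

lemma decay_conv_integrable:
  assumes "decaying D a c \<delta>" "g \<in> borel_measurable borel" "\<And>t. \<bar>g t\<bar> \<le> G"
  shows "set_integrable lborel {0..} (\<lambda>r. decay_kernel \<delta> t r * g (t - r))"
proof (rule set_integrable_bound)
  note [measurable] = decayingD(2)[OF assms(1)] assms(2)
  show "set_integrable lborel {0..} (\<lambda>r. exp (c - a * r) * G)"
    by (rule set_integrable_mult_left) (use exp_decay_integral decayingD(1)[OF assms(1)] in auto)
  show "set_borel_measurable lborel {0..} (\<lambda>r. decay_kernel \<delta> t r * g (t - r))"
    unfolding set_borel_measurable_def by measurable
qed (use abs_decay_kernel_mult_le[OF assms(1) _ assms(3)] in \<open>auto intro!: AE_I2 intro: order_trans[OF _ abs_ge_self]\<close>)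

text \<open>The kernel is dominated by \<open>exp (c - a * r)\<close>, whose integral is
  \<open>exp c / a\<close>. This operator bound is one factor of the contraction constant.\<close>

lemma abs_decay_conv_le:
  assumes "decaying D a c \<delta>" "g \<in> borel_measurable borel" "\<And>t. \<bar>g t\<bar> \<le> G"
  shows "\<bar>decay_conv \<delta> g t\<bar> \<le> exp c / a * G"
proof -
  note int = decay_conv_integrable[OF assms, of t]
  note E = exp_decay_integral[OF decayingD(1)[OF assms(1)], of c]
  have "\<bar>decay_conv \<delta> g t\<bar> \<le> (LBINT r:{0..}. \<bar>decay_kernel \<delta> t r * g (t - r)\<bar>)"
    using set_integral_norm_bound[OF int] by (simp add: decay_conv_def)
  also have "\<dots> \<le> (LBINT r:{0..}. exp (c - a * r) * G)"
    by (rule set_integral_mono)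
      (use E(1) set_integrable_abs[OF int] abs_decay_kernel_mult_le[OF assms(1) _ assms(3)] in auto)
  finally show ?thesis
    using E by simp
qed

lemma decay_conv_nonneg:
  assumes "\<And>t. 0 \<le> g t"
  shows "0 \<le> decay_conv \<delta> g t"
  unfolding decay_conv_def set_lebesgue_integral_def
  using assms decay_kernel_pos[of \<delta> t]
  by (intro Bochner_Integration.integral_nonneg) (auto simp: less_imp_le)

lemma decay_conv_diff:
  assumes "decaying D a c \<delta>" "g \<in> borel_measurable borel" "\<And>t. \<bar>g t\<bar> \<le> G"
    "h \<in> borel_measurable borel" "\<And>t. \<bar>h t\<bar> \<le> H"
  shows "decay_conv \<delta> g t - decay_conv \<delta> h t = decay_conv \<delta> (\<lambda>s. g s - h s) t"
  unfolding decay_conv_def right_diff_distrib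
  by (intro set_integral_diff(2)[symmetric] decay_conv_integrable[OF assms(1-3)]
      decay_conv_integrable[OF assms(1,4,5)])

text \<open>Dominated convergence acts twice: inside the exponent of the kernel, over a bounded
  interval, and then over the half line, where \<open>exp (c - a * r) * G\<close> is a majorant
  independent of \<open>n\<close>.\<close>

lemma tendsto_decay_conv:
  assumes "\<And>n. decaying D a c (\<delta> n)" "\<And>t. (\<lambda>n. \<delta> n t) \<longlonglongrightarrow> \<delta>' t"
    and "\<And>n. g n \<in> borel_measurable borel" "\<And>n t. \<bar>g n t\<bar> \<le> G" "\<And>t. (\<lambda>n. g n t) \<longlonglongrightarrow> g' t"
  shows "(\<lambda>n. decay_conv (\<delta> n) (g n) t) \<longlonglongrightarrow> decay_conv \<delta>' g' t"
  unfolding decay_conv_def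
proof (rule set_integral_dominated_convergence_real[where w = "\<lambda>r. exp (c - a * r) * G"])
  show "set_integrable lborel {0..} (\<lambda>r. exp (c - a * r) * G)"
    by (rule set_integrable_mult_left) (use exp_decay_integral(1)[OF decayingD(1)[OF assms(1)]] in auto)
  show "(\<lambda>r. decay_kernel (\<delta> n) t r * g n (t - r)) \<in> borel_measurable borel" for n
  proof -
    note [measurable] = decayingD(2)[OF assms(1)] assms(3)
    show ?thesis by measurable
  qed
  show "(\<lambda>n. decay_kernel (\<delta> n) t r * g n (t - r)) \<longlonglongrightarrow> decay_kernel \<delta>' t r * g' (t - r)" for r
    unfolding decay_kernel_def
    by (intro tendsto_intros tendsto_interval_integral[OF assms(1,2)] assms(5))
qed (use abs_decay_kernel_mult_le[OF assms(1) _ assms(4)] in auto)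

lemma decay_conv_translate:
  "decay_conv (\<lambda>t. \<delta> (t + s)) (\<lambda>t. g (t + s)) t = decay_conv \<delta> g (t + s)"
  by (simp add: decay_conv_def decay_kernel_def algebra_simps)

section \<open>The fixed point and its dependence on the coefficients\<close>

text \<open>A mean value inequality: on \<open>{- b..}\<close> the slope of \<open>exp (- x)\<close>
  has modulus at most \<open>exp b\<close>. It follows from
  \<open>1 + x \<le> exp x\<close>.\<close>

lemma abs_exp_minus_diff_le:
  fixes u v b :: real
  assumes "- b \<le> u" "- b \<le> v"
  shows "\<bar>exp (- u) - exp (- v)\<bar> \<le> exp b * \<bar>u - v\<bar>"
proof -
  have *: "exp (- x) - exp (- y) \<le> exp b * (y - x)" if "- b \<le> x" "x \<le> y" for x y :: real
  proof -
    have "exp (- x) - exp (- y) = exp (- x) * (1 - exp (x - y))"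
      by (simp add: algebra_simps flip: exp_add)
    also have "\<dots> \<le> exp (- x) * (y - x)"
      using exp_ge_add_one_self[of "x - y"] by (intro mult_left_mono) (linarith, simp)
    also have "\<dots> \<le> exp b * (y - x)"
      using that by (intro mult_right_mono) auto
    finally show ?thesis .
  qed
  show ?thesis
  proof (cases "u \<le> v")
    case True
    then show ?thesis using *[of u v] assms by auto
  next
    case False
    then show ?thesis using *[of v u] assms by auto
  qed
qed

lemma halving_differences_lim:
  fixes x :: "nat \<Rightarrow> real"
  assumes "\<And>k. \<bar>x (Suc k) - x k\<bar> \<le> C * (1/2) ^ k"
  shows "x \<longlonglongrightarrow> lim x" "\<bar>x k - lim x\<bar> \<le> 2 * C * (1/2) ^ k"
proof -
  \<comment> \<open>The subtracted term is what lets the induction on \<open>m\<close> close: it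
    shrinks by exactly the amount that one further difference may add.\<close>
  have tail: "\<bar>x (k + m) - x k\<bar> \<le> 2 * C * (1/2) ^ k - 2 * C * (1/2) ^ (k + m)" for k m
  proof (induction m)
    case (Suc m)
    then show ?case using assms[of "k + m"] by simp
  qed simp
  have "0 \<le> C"
    using assms[of 0] by simp
  then have bound: "\<bar>x (k + m) - x k\<bar> \<le> 2 * C * (1/2) ^ k" for k m
    by (intro order_trans[OF tail]) simp
  have "summable (\<lambda>k. x (Suc k) - x k)"
    by (rule summable_comparison_test'[where g = "\<lambda>k. C * (1/2) ^ k"])
      (use assms in \<open>auto intro!: summable_mult summable_geometric\<close>)
  then have "convergent (\<lambda>n. x n - x 0)"
    by (simp add: summable_iff_convergent sum_lessThan_telescope)
  then have "convergent x"
    using convergent_add[OF _ convergent_const[of "x 0"]] by fastforce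
  then show lim: "x \<longlonglongrightarrow> lim x"
    by (simp add: convergent_LIMSEQ_iff)
  have "(\<lambda>m. \<bar>x (m + k) - x k\<bar>) \<longlonglongrightarrow> \<bar>lim x - x k\<bar>"
    by (intro tendsto_intros LIMSEQ_ignore_initial_segment lim)
  then have "\<bar>lim x - x k\<bar> \<le> 2 * C * (1/2) ^ k"
    by (rule LIMSEQ_le_const2) (use bound in \<open>simp add: add.commute[of _ k]\<close>)
  then show "\<bar>x k - lim x\<bar> \<le> 2 * C * (1/2) ^ k"
    by (simp add: abs_minus_commute)
qed

section \<open>Picard iteration for the integral equation\<close>

definition lw_production :: "(real \<Rightarrow> real) \<Rightarrow> real \<Rightarrow> real \<Rightarrow> (real \<Rightarrow> real) \<Rightarrow> real \<Rightarrow> real" where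
  "lw_production p \<gamma> \<tau> y t = p t * exp (- \<gamma> * y (t - \<tau>))"

primrec lw_iterate ::
    "(real \<Rightarrow> real) \<Rightarrow> (real \<Rightarrow> real) \<Rightarrow> real \<Rightarrow> real \<Rightarrow> nat \<Rightarrow> real \<Rightarrow> real" where
  "lw_iterate \<delta> p \<gamma> \<tau> 0 = (\<lambda>t. 0)"
| "lw_iterate \<delta> p \<gamma> \<tau> (Suc k) = decay_conv \<delta> (lw_production p \<gamma> \<tau> (lw_iterate \<delta> p \<gamma> \<tau> k))"

text \<open>A pointwise limit, so that profiles belonging to different coefficients can be compared
  at a single time. Convergence is established under \<open>lw_contractive\<close>.\<close>

definition lw_profile :: "(real \<Rightarrow> real) \<Rightarrow> (real \<Rightarrow> real) \<Rightarrow> real \<Rightarrow> real \<Rightarrow> real \<Rightarrow> real" where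
  "lw_profile \<delta> p \<gamma> \<tau> t = lim (\<lambda>k. lw_iterate \<delta> p \<gamma> \<tau> k t)"

text \<open>The factor \<open>exp c / a\<close> comes from the convolution, and
  \<open>P * \<gamma>\<close> is a Lipschitz constant of the production on nonnegative functions.
  The constants are parameters so that one choice serves all translates and their limits.\<close>

definition lw_contractive ::
    "real \<Rightarrow> real \<Rightarrow> real \<Rightarrow> real \<Rightarrow> real \<Rightarrow> (real \<Rightarrow> real) \<Rightarrow> (real \<Rightarrow> real) \<Rightarrow> bool" where
  "lw_contractive D a c P \<gamma> \<delta> p \<longleftrightarrow> decaying D a c \<delta> \<and> p \<in> borel_measurable borel \<and>
     (\<forall>t. 0 \<le> p t \<and> p t \<le> P) \<and> 0 \<le> \<gamma> \<and> exp c / a * (P * \<gamma>) \<le> 1/2"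

lemma lw_contractiveD:
  assumes "lw_contractive D a c P \<gamma> \<delta> p"
  shows "decaying D a c \<delta>" "p \<in> borel_measurable borel" "0 \<le> p t" "p t \<le> P" "0 \<le> \<gamma>"
    "exp c / a * (P * \<gamma>) \<le> 1/2" "0 \<le> P"
  using assms order_trans unfolding lw_contractive_def by blast+

lemma lw_contractive_translate:
  assumes "lw_contractive D a c P \<gamma> \<delta> p"
  shows "lw_contractive D a c P \<gamma> (\<lambda>t. \<delta> (t + s)) (\<lambda>t. p (t + s))"
proof -
  note [measurable] = lw_contractiveD(2)[OF assms]
  have "(\<lambda>t. p (t + s)) \<in> borel_measurable borel"
    by measurable
  then show ?thesis
    using assms decaying_translate unfolding lw_contractive_def by auto
qed

lemma lw_contractive_lim:
  assumes "\<And>n. lw_contractive D a c P \<gamma> (\<delta> n) (p n)"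
    and "\<And>t. (\<lambda>n. \<delta> n t) \<longlonglongrightarrow> \<delta>' t" "\<And>t. (\<lambda>n. p n t) \<longlonglongrightarrow> p' t"
  shows "lw_contractive D a c P \<gamma> \<delta>' p'"
  unfolding lw_contractive_def
proof (intro conjI allI)
  note * = lw_contractiveD[OF assms(1)]
  show "decaying D a c \<delta>'"
    by (rule decaying_lim[OF *(1) assms(2)])
  show "p' \<in> borel_measurable borel"
    by (rule borel_measurable_LIMSEQ_real[OF assms(3) *(2)])
  show "0 \<le> p' t" for t
    by (rule LIMSEQ_le_const[OF assms(3)]) (use *(3) in auto)
  show "p' t \<le> P" for t
    by (rule LIMSEQ_le_const2[OF assms(3)]) (use *(4) in auto)
qed (use lw_contractiveD(5,6)[OF assms(1)] in auto)

lemma lw_production_measurable: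
  assumes [measurable]: "p \<in> borel_measurable borel" "y \<in> borel_measurable borel"
  shows "lw_production p \<gamma> \<tau> y \<in> borel_measurable borel"
  unfolding lw_production_def[abs_def] by measurable

lemma lw_production_bounds:
  assumes "lw_contractive D a c P \<gamma> \<delta> p" "\<And>t. 0 \<le> y t"
  shows "0 \<le> lw_production p \<gamma> \<tau> y t" "lw_production p \<gamma> \<tau> y t \<le> P" "\<bar>lw_production p \<gamma> \<tau> y t\<bar> \<le> P"
proof -
  show *: "0 \<le> lw_production p \<gamma> \<tau> y t"
    unfolding lw_production_def using lw_contractiveD(3)[OF assms(1)] by simp
  have "lw_production p \<gamma> \<tau> y t \<le> P * 1"
    unfolding lw_production_def
    by (intro mult_mono) (use lw_contractiveD[OF assms(1)] assms(2) in auto)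
  then show "lw_production p \<gamma> \<tau> y t \<le> P" "\<bar>lw_production p \<gamma> \<tau> y t\<bar> \<le> P"
    using * by auto
qed

text \<open>Applied with \<open>b = 0\<close> to the nonnegative iterates and with
  \<open>b = 1\<close> to solutions that may dip below zero.\<close>

lemma abs_lw_production_diff_le:
  assumes "0 \<le> p t" "p t \<le> P" "0 \<le> \<gamma>" "- b \<le> y (t - \<tau>)" "- b \<le> z (t - \<tau>)"
  shows "\<bar>lw_production p \<gamma> \<tau> y t - lw_production p \<gamma> \<tau> z t\<bar>
    \<le> P * (exp (\<gamma> * b) * \<gamma>) * \<bar>y (t - \<tau>) - z (t - \<tau>)\<bar>"
proof -
  have "\<bar>exp (- (\<gamma> * y (t - \<tau>))) - exp (- (\<gamma> * z (t - \<tau>)))\<bar>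
    \<le> exp (\<gamma> * b) * \<bar>\<gamma> * y (t - \<tau>) - \<gamma> * z (t - \<tau>)\<bar>"
    using mult_left_mono[OF assms(4,3)] mult_left_mono[OF assms(5,3)]
    by (intro abs_exp_minus_diff_le) auto
  also have "\<dots> = exp (\<gamma> * b) * \<gamma> * \<bar>y (t - \<tau>) - z (t - \<tau>)\<bar>"
    using assms(3) by (simp add: abs_mult flip: right_diff_distrib)
  finally have "p t * \<bar>exp (- (\<gamma> * y (t - \<tau>))) - exp (- (\<gamma> * z (t - \<tau>)))\<bar>
    \<le> P * (exp (\<gamma> * b) * \<gamma> * \<bar>y (t - \<tau>) - z (t - \<tau>)\<bar>)"
    using assms(1,2) by (intro mult_mono) auto
  then show ?thesis
    using assms(1) by (simp add: lw_production_def abs_mult mult.assoc flip: right_diff_distrib)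
qed

lemma lw_iterate_props:
  assumes "lw_contractive D a c P \<gamma> \<delta> p"
  shows "lw_iterate \<delta> p \<gamma> \<tau> k \<in> borel_measurable borel" "0 \<le> lw_iterate \<delta> p \<gamma> \<tau> k t"
proof -
  have "lw_iterate \<delta> p \<gamma> \<tau> k \<in> borel_measurable borel \<and> (\<forall>t. 0 \<le> lw_iterate \<delta> p \<gamma> \<tau> k t)"
  proof (induction k)
    case (Suc k)
    then have "lw_production p \<gamma> \<tau> (lw_iterate \<delta> p \<gamma> \<tau> k) \<in> borel_measurable borel"
      using lw_contractiveD(2)[OF assms] lw_production_measurable by blast
    then show ?case
      using Suc decay_conv_measurable[OF decayingD(2)[OF lw_contractiveD(1)[OF assms]]]
        decay_conv_nonneg lw_production_bounds(1)[OF assms]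
      by auto
  qed auto
  then show "lw_iterate \<delta> p \<gamma> \<tau> k \<in> borel_measurable borel" "0 \<le> lw_iterate \<delta> p \<gamma> \<tau> k t"
    by auto
qed

lemma lw_iterate_production:
  assumes "lw_contractive D a c P \<gamma> \<delta> p"
  shows "lw_production p \<gamma> \<tau> (lw_iterate \<delta> p \<gamma> \<tau> k) \<in> borel_measurable borel"
    and "\<bar>lw_production p \<gamma> \<tau> (lw_iterate \<delta> p \<gamma> \<tau> k) t\<bar> \<le> P"
  using lw_production_measurable[OF lw_contractiveD(2)[OF assms] lw_iterate_props(1)[OF assms]]
    lw_production_bounds(3)[OF assms lw_iterate_props(2)[OF assms]]
  by auto

text \<open>The zeroth iterate is zero, so the first difference is one convolution of a function
  bounded by \<open>P\<close>; every further application of the map halves the bound.\<close>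

lemma lw_iterate_diff:
  assumes "lw_contractive D a c P \<gamma> \<delta> p"
  shows "\<bar>lw_iterate \<delta> p \<gamma> \<tau> (Suc k) t - lw_iterate \<delta> p \<gamma> \<tau> k t\<bar> \<le> exp c / a * P * (1/2) ^ k"
proof (induction k arbitrary: t)
  case 0
  show ?case
    using abs_decay_conv_le[OF lw_contractiveD(1)[OF assms] lw_iterate_production[OF assms, where k = 0]]
    by simp
next
  case (Suc k)
  note * = lw_contractiveD[OF assms]
  let ?y = "lw_iterate \<delta> p \<gamma> \<tau>" and ?C = "exp c / a * P * (1/2) ^ k"
  let ?d = "\<lambda>t. lw_production p \<gamma> \<tau> (?y (Suc k)) t - lw_production p \<gamma> \<tau> (?y k) t"
  have C: "0 \<le> ?C"
    using order_trans[OF abs_ge_zero Suc] .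
  have d: "\<bar>?d t\<bar> \<le> P * \<gamma> * ?C" for t
  proof -
    have "\<bar>?d t\<bar> \<le> P * (exp (\<gamma> * 0) * \<gamma>) * \<bar>?y (Suc k) (t - \<tau>) - ?y k (t - \<tau>)\<bar>"
      by (rule abs_lw_production_diff_le)
        (use *(3-5) lw_iterate_props(2)[OF assms] in \<open>simp_all del: lw_iterate.simps\<close>)
    also have "\<dots> \<le> P * (exp (\<gamma> * 0) * \<gamma>) * ?C"
      by (intro mult_left_mono Suc) (use *(5,7) in auto)
    finally show ?thesis by simp
  qed
  have "?y (Suc (Suc k)) t - ?y (Suc k) t = decay_conv \<delta> ?d t"
    using decay_conv_diff[OF *(1) lw_iterate_production[OF assms, where k = "Suc k"]
        lw_iterate_production[OF assms, where k = k]] by simp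
  also have "\<bar>decay_conv \<delta> ?d t\<bar> \<le> exp c / a * (P * \<gamma> * ?C)"
    by (rule abs_decay_conv_le[OF *(1) _ d]) (intro borel_measurable_diff lw_iterate_production(1)[OF assms])
  also have "\<dots> = exp c / a * (P * \<gamma>) * ?C"
    by simp
  also have "\<dots> \<le> 1/2 * ?C"
    by (intro mult_right_mono *(6) C)
  finally show ?case
    by simp
qed

text \<open>The rate depends only on the constants of the class, neither on \<open>t\<close> nor on
  the coefficients; \<open>tendsto_lw_profile\<close> rests on this uniformity.\<close>

lemma lw_iterate_tendsto_profile:
  assumes "lw_contractive D a c P \<gamma> \<delta> p"
  shows "(\<lambda>k. lw_iterate \<delta> p \<gamma> \<tau> k t) \<longlonglongrightarrow> lw_profile \<delta> p \<gamma> \<tau> t"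
    and "\<bar>lw_iterate \<delta> p \<gamma> \<tau> k t - lw_profile \<delta> p \<gamma> \<tau> t\<bar> \<le> 2 * (exp c / a * P) * (1/2) ^ k"
  unfolding lw_profile_def
  by (rule halving_differences_lim[OF lw_iterate_diff[OF assms]])+

lemma lw_profile_nonneg:
  assumes "lw_contractive D a c P \<gamma> \<delta> p"
  shows "0 \<le> lw_profile \<delta> p \<gamma> \<tau> t"
  by (rule LIMSEQ_le_const[OF lw_iterate_tendsto_profile(1)[OF assms]])
    (use lw_iterate_props(2)[OF assms] in auto)

text \<open>Both sides are limits of the shifted iterates, the right one by dominated convergence
  with \<delta> held fixed.\<close>

lemma lw_profile_fixed_point:
  assumes "lw_contractive D a c P \<gamma> \<delta> p"
  shows "lw_profile \<delta> p \<gamma> \<tau> t = decay_conv \<delta> (lw_production p \<gamma> \<tau> (lw_profile \<delta> p \<gamma> \<tau>)) t"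
proof (rule LIMSEQ_unique)
  show "(\<lambda>k. lw_iterate \<delta> p \<gamma> \<tau> (Suc k) t) \<longlonglongrightarrow> lw_profile \<delta> p \<gamma> \<tau> t"
    by (rule LIMSEQ_Suc[OF lw_iterate_tendsto_profile(1)[OF assms]])
  show "(\<lambda>k. lw_iterate \<delta> p \<gamma> \<tau> (Suc k) t) \<longlonglongrightarrow>
      decay_conv \<delta> (lw_production p \<gamma> \<tau> (lw_profile \<delta> p \<gamma> \<tau>)) t"
    unfolding lw_iterate.simps(2)
  proof (rule tendsto_decay_conv[OF lw_contractiveD(1)[OF assms] tendsto_const])
    fix t show "(\<lambda>k. lw_production p \<gamma> \<tau> (lw_iterate \<delta> p \<gamma> \<tau> k) t) \<longlonglongrightarrow>
      lw_production p \<gamma> \<tau> (lw_profile \<delta> p \<gamma> \<tau>) t"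
      unfolding lw_production_def
      by (intro tendsto_intros lw_iterate_tendsto_profile(1)[OF assms])
  qed (rule lw_production_measurable lw_production_bounds(3)[OF assms] lw_iterate_props[OF assms]
      lw_contractiveD(2)[OF assms])+
qed

text \<open>Each iterate depends continuously on the coefficients, by induction on \<open>k\<close>,
  and iterates approximate profiles at a rate uniform in \<open>n\<close>. So \<open>k\<close> can
  be fixed first and \<open>n\<close> made large afterwards.\<close>

lemma tendsto_lw_profile:
  assumes "\<And>n. lw_contractive D a c P \<gamma> (\<delta> n) (p n)"
    and "\<And>t. (\<lambda>n. \<delta> n t) \<longlonglongrightarrow> \<delta>' t" "\<And>t. (\<lambda>n. p n t) \<longlonglongrightarrow> p' t"
  shows "(\<lambda>n. lw_profile (\<delta> n) (p n) \<gamma> \<tau> t) \<longlonglongrightarrow> lw_profile \<delta>' p' \<gamma> \<tau> t"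
proof -
  note lim = lw_contractive_lim[OF assms]
  have iter: "(\<lambda>n. lw_iterate (\<delta> n) (p n) \<gamma> \<tau> k t) \<longlonglongrightarrow> lw_iterate \<delta>' p' \<gamma> \<tau> k t" for k t
  proof (induction k arbitrary: t)
    case (Suc k)
    show ?case
      unfolding lw_iterate.simps(2)
    proof (rule tendsto_decay_conv[OF lw_contractiveD(1)[OF assms(1)] assms(2)])
      fix t show "(\<lambda>n. lw_production (p n) \<gamma> \<tau> (lw_iterate (\<delta> n) (p n) \<gamma> \<tau> k) t) \<longlonglongrightarrow>
        lw_production p' \<gamma> \<tau> (lw_iterate \<delta>' p' \<gamma> \<tau> k) t"
        unfolding lw_production_def by (intro tendsto_intros assms(3) Suc)
    qed (rule lw_production_measurable lw_production_bounds(3)[OF assms(1)]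
        lw_iterate_props[OF assms(1)] lw_contractiveD(2)[OF assms(1)])+
  qed simp
  have "\<exists>N. \<forall>n\<ge>N. \<bar>lw_profile (\<delta> n) (p n) \<gamma> \<tau> t - lw_profile \<delta>' p' \<gamma> \<tau> t\<bar> < e" if "0 < e" for e
  proof -
    have "(\<lambda>k. 2 * (exp c / a * P) * (1/2) ^ k) \<longlonglongrightarrow> 2 * (exp c / a * P) * 0"
      by (intro tendsto_intros LIMSEQ_power_zero) auto
    then obtain k where k: "2 * (exp c / a * P) * (1/2) ^ k < e / 3"
      using order_tendstoD(2)[of "\<lambda>k. 2 * (exp c / a * P) * (1/2) ^ k" 0 sequentially "e / 3"] \<open>0 < e\<close>
      by (auto simp: eventually_sequentially)
    obtain N where N: "\<And>n. n \<ge> N \<Longrightarrow>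
        \<bar>lw_iterate (\<delta> n) (p n) \<gamma> \<tau> k t - lw_iterate \<delta>' p' \<gamma> \<tau> k t\<bar> < e / 3"
      using LIMSEQ_D[OF iter[of k t], of "e / 3"] \<open>0 < e\<close> by auto
    have triangle: "\<bar>u - v\<bar> < e" if "\<bar>x - u\<bar> \<le> q" "\<bar>y - v\<bar> \<le> q" "\<bar>x - y\<bar> < e / 3" "q < e / 3"
      for u v x y q :: real
      using that by linarith
    show ?thesis
      using triangle[OF lw_iterate_tendsto_profile(2)[OF assms(1)] lw_iterate_tendsto_profile(2)[OF lim] N k]
      by blast
  qed
  then show ?thesis
    unfolding LIMSEQ_iff by simp
qed

lemma lw_profile_translate:
  "lw_profile (\<lambda>t. \<delta> (t + s)) (\<lambda>t. p (t + s)) \<gamma> \<tau> t = lw_profile \<delta> p \<gamma> \<tau> (t + s)"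
proof -
  have "lw_iterate (\<lambda>t. \<delta> (t + s)) (\<lambda>t. p (t + s)) \<gamma> \<tau> k t = lw_iterate \<delta> p \<gamma> \<tau> k (t + s)" for k t
  proof (induction k arbitrary: t)
    case (Suc k)
    have "lw_production (\<lambda>t. p (t + s)) \<gamma> \<tau> (lw_iterate (\<lambda>t. \<delta> (t + s)) (\<lambda>t. p (t + s)) \<gamma> \<tau> k)
      = (\<lambda>t. lw_production p \<gamma> \<tau> (lw_iterate \<delta> p \<gamma> \<tau> k) (t + s))"
      by (simp add: fun_eq_iff lw_production_def Suc algebra_simps)
    then show ?case
      by (simp add: decay_conv_translate)
  qed simp
  then show ?thesis
    by (simp add: lw_profile_def)
qed

section \<open>Differentiating the fixed point\<close>

lemma reflected_interval_integral:
  fixes \<delta> :: "real \<Rightarrow> real"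
  assumes "continuous_on UNIV \<delta>"
  shows "(LBINT v:{0..r}. \<delta> (t - v)) = integral {t - r..t} \<delta>"
proof -
  have "(LBINT v:{0..r}. \<delta> (t - v)) = (LBINT s:{t - r..t}. \<delta> s)"
    unfolding set_lebesgue_integral_def
    by (subst lborel_integral_real_affine[where c = "-1" and t = t])
      (auto intro!: Bochner_Integration.integral_cong simp: indicator_def)
  also have "\<dots> = integral {t - r..t} \<delta>"
    by (intro set_borel_integral_eq_integral borel_integrable_atLeastAtMost')
      (rule continuous_on_subset[OF assms(1)], simp)
  finally show ?thesis .
qed

lemma decay_kernel_eq_integral:
  assumes "continuous_on UNIV \<delta>"
  shows "decay_kernel \<delta> t r = exp (- integral {t - r..t} \<delta>)"
  by (simp add: decay_kernel_def reflected_interval_integral[OF assms])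

text \<open>Since the propagator is multiplicative in time, everything before \<open>b\<close>
  enters only through the value at \<open>b\<close>. This gives the usual variation of constants
  formula on \<open>{b..t}\<close>.\<close>

lemma decay_conv_split:
  assumes "decaying D a c \<delta>" "continuous_on UNIV \<delta>" "continuous_on UNIV g" "\<And>t. \<bar>g t\<bar> \<le> G" "b \<le> t"
  shows "decay_conv \<delta> g t = exp (- integral {b..t} \<delta>) * decay_conv \<delta> g b
    + integral {b..t} (\<lambda>s. exp (- integral {s..t} \<delta>) * g s)"
proof -
  let ?f = "\<lambda>r. decay_kernel \<delta> t r * g (t - r)"
  have [measurable]: "g \<in> borel_measurable borel"
    using assms(3) by (rule borel_measurable_continuous_onI)
  have f: "set_integrable lborel {0..} ?f"
    by (rule decay_conv_integrable[OF assms(1) _ assms(4)]) measurable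
  have "integral {b - r..t} \<delta> = integral {b - r..b} \<delta> + integral {b..t} \<delta>" if "0 \<le> r" for r :: real
    using that \<open>b \<le> t\<close>
    by (intro Henstock_Kurzweil_Integration.integral_combine[symmetric] integrable_continuous_real continuous_on_subset[OF assms(2)]) simp_all
  then have kernel: "decay_kernel \<delta> t (t - b + r) = exp (- integral {b..t} \<delta>) * decay_kernel \<delta> b r"
    if "0 \<le> r" for r
    using that \<open>b \<le> t\<close> by (simp add: decay_kernel_eq_integral[OF assms(2)] flip: exp_add)
  have "(LBINT r:{t - b..}. ?f r) = (LBINT r:{0..}. ?f (t - b + r))"
    unfolding set_lebesgue_integral_def
    by (subst lborel_integral_real_affine[where c = 1 and t = "t - b"])
      (auto intro!: Bochner_Integration.integral_cong simp: indicator_def)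
  also have "\<dots> = (LBINT r:{0..}. exp (- integral {b..t} \<delta>) * (decay_kernel \<delta> b r * g (b - r)))"
    by (rule set_lebesgue_integral_cong) (auto simp: kernel)
  also have "\<dots> = exp (- integral {b..t} \<delta>) * decay_conv \<delta> g b"
    by (simp add: decay_conv_def)
  finally have tail: "(LBINT r:{t - b..}. ?f r) = exp (- integral {b..t} \<delta>) * decay_conv \<delta> g b" .
  \<comment> \<open>The half-open interval keeps the two pieces of the half line disjoint; the
    missing endpoint is a null set.\<close>
  have "(LBINT r:{0..<t - b}. ?f r) = (LBINT r:{0..t - b}. ?f r)"
    by (rule set_integral_discrete_difference[where X = "{t - b}"]) auto
  also have "\<dots> = (LBINT s:{b..t}. ?f (t - s))"
    unfolding set_lebesgue_integral_def
    by (subst lborel_integral_real_affine[where c = "-1" and t = t])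
      (auto intro!: Bochner_Integration.integral_cong simp: indicator_def)
  also have "\<dots> = (LBINT s:{b..t}. exp (- integral {s..t} \<delta>) * g s)"
    by (rule set_lebesgue_integral_cong) (auto simp: decay_kernel_eq_integral[OF assms(2)])
  also have "\<dots> = integral {b..t} (\<lambda>s. exp (- integral {s..t} \<delta>) * g s)"
  proof (rule set_borel_integral_eq_integral(2)[OF borel_integrable_atLeastAtMost'])
    show "continuous_on {b..t} (\<lambda>s. exp (- integral {s..t} \<delta>) * g s)"
      by (intro continuous_intros indefinite_integral_continuous_1' integrable_continuous_real
          continuous_on_subset[OF assms(2)] continuous_on_subset[OF assms(3)]) auto
  qed
  finally have head: "(LBINT r:{0..<t - b}. ?f r) = integral {b..t} (\<lambda>s. exp (- integral {s..t} \<delta>) * g s)" .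
  have "{0..} = {0..<t - b} \<union> {t - b..}"
    using \<open>b \<le> t\<close> by auto
  then have "decay_conv \<delta> g t = (LBINT r:{0..<t - b} \<union> {t - b..}. ?f r)"
    by (simp add: decay_conv_def)
  also have "\<dots> = (LBINT r:{0..<t - b}. ?f r) + (LBINT r:{t - b..}. ?f r)"
    by (rule set_integral_Un) (use \<open>b \<le> t\<close> in \<open>auto intro!: set_integrable_subset[OF f]\<close>)
  finally show ?thesis
    unfolding head tail by simp
qed

lemma decay_conv_has_derivative:
  assumes "decaying D a c \<delta>" "continuous_on UNIV \<delta>" "continuous_on UNIV g" "\<And>t. \<bar>g t\<bar> \<le> G" "b \<le> t"
  shows "(decay_conv \<delta> g has_real_derivative - \<delta> t * decay_conv \<delta> g t + g t) (at t within {b..})"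
proof -
  \<comment> \<open>\<open>?T\<close> lies strictly to the right of \<open>t\<close>, so derivatives
    within the compact interval \<open>{b..?T}\<close> agree at \<open>t\<close> with those within
    \<open>{b..}\<close>.\<close>
  let ?A = "\<lambda>s. integral {b..s} \<delta>" and ?y = "decay_conv \<delta> g" and ?T = "t + 1"
  note cont = continuous_on_subset[OF assms(2) subset_UNIV] continuous_on_subset[OF assms(3) subset_UNIV]
  have A: "(?A has_real_derivative \<delta> t) (at t within {b..?T})"
    by (rule integral_has_real_derivative[OF cont(1)]) (use \<open>b \<le> t\<close> in auto)
  have "continuous_on {b..?T} (\<lambda>s. exp (?A s) * g s)"
    by (intro continuous_on_mult continuous_on_exp cont
        indefinite_integral_continuous_1[OF integrable_continuous_real[OF cont(1)]])
  then have B: "((\<lambda>s. integral {b..s} (\<lambda>s. exp (?A s) * g s)) has_real_derivative exp (?A t) * g t)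
      (at t within {b..?T})"
    by (rule integral_has_real_derivative) (use \<open>b \<le> t\<close> in simp)
  \<comment> \<open>With \<open>exp (- ?A s)\<close> pulled out, \<open>s\<close> occurs in the
    integral only as an endpoint, so no differentiation under the integral sign is needed.\<close>
  have y: "?y s = exp (- ?A s) * (?y b + integral {b..s} (\<lambda>s. exp (?A s) * g s))" if "b \<le> s" for s
  proof -
    have "integral {b..s} (\<lambda>r. exp (- integral {r..s} \<delta>) * g r)
        = integral {b..s} (\<lambda>r. exp (- ?A s) * (exp (?A r) * g r))"
    proof (rule integral_cong)
      fix r assume "r \<in> {b..s}"
      then have "?A r + integral {r..s} \<delta> = ?A s"
        by (intro Henstock_Kurzweil_Integration.integral_combine integrable_continuous_real cont) auto
      then show "exp (- integral {r..s} \<delta>) * g r = exp (- ?A s) * (exp (?A r) * g r)"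
        by (simp flip: exp_add mult.assoc)
    qed
    then show ?thesis
      using decay_conv_split[OF assms(1-4) that] by (simp add: distrib_left)
  qed
  let ?B = "\<lambda>s. integral {b..s} (\<lambda>s. exp (?A s) * g s)"
  have "((\<lambda>s. exp (- ?A s) * (?y b + ?B s)) has_real_derivative
      exp (- ?A t) * - \<delta> t * (?y b + ?B t) + (0 + exp (?A t) * g t) * exp (- ?A t)) (at t within {b..?T})"
    by (rule DERIV_mult[OF DERIV_chain2[OF DERIV_exp DERIV_minus[OF A]] DERIV_add[OF DERIV_const B]])
  moreover have "exp (- ?A t) * - \<delta> t * (?y b + ?B t) + (0 + exp (?A t) * g t) * exp (- ?A t)
      = - \<delta> t * ?y t + g t"
    unfolding y[OF \<open>b \<le> t\<close>] by (simp add: exp_minus)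
  ultimately have "((\<lambda>s. exp (- ?A s) * (?y b + ?B s)) has_real_derivative - \<delta> t * ?y t + g t)
      (at t within {b..?T})"
    by simp
  then have "(?y has_real_derivative - \<delta> t * ?y t + g t) (at t within {b..?T})"
  proof (rule has_field_derivative_transform_within[where d = 1])
    show "t \<in> {b..?T}"
      using \<open>b \<le> t\<close> by simp
    show "exp (- ?A s) * (?y b + ?B s) = ?y s" if "s \<in> {b..?T}" for s
      by (rule y[symmetric]) (use that in simp)
  qed simp
  moreover have "at t within {b..?T} = at t within {b..}"
  proof (rule at_within_nhd[where S = "{..<?T}"])
    have "{b..?T} \<inter> {..<?T} = {b..} \<inter> {..<?T}"
      by (rule set_eqI) auto
    then show "{b..?T} \<inter> {..<?T} - {t} = {b..} \<inter> {..<?T} - {t}"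
      by simp
  qed simp_all
  ultimately show ?thesis
    by simp
qed

text \<open>Continuity in \<open>t\<close> is continuous dependence on the translated coefficients.\<close>

lemma lw_profile_continuous:
  assumes "lw_contractive D a c P \<gamma> \<delta> p" "continuous_on UNIV \<delta>" "continuous_on UNIV p"
  shows "continuous_on UNIV (lw_profile \<delta> p \<gamma> \<tau>)"
proof -
  have "isCont (lw_profile \<delta> p \<gamma> \<tau>) t" for t
    unfolding continuous_at_sequentially o_def
  proof (intro allI impI)
    fix x assume x: "x \<longlonglongrightarrow> t"
    have shift: "(\<lambda>n. f (s + (x n - t))) \<longlonglongrightarrow> f s" if "continuous_on UNIV f" for f :: "real \<Rightarrow> real" and s
    proof (rule continuous_on_tendsto_compose[OF that])
      show "(\<lambda>n. s + (x n - t)) \<longlonglongrightarrow> s"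
        using tendsto_add[OF tendsto_const[of s] tendsto_diff[OF x tendsto_const[of t]]] by simp
    qed auto
    have "(\<lambda>n. lw_profile (\<lambda>s. \<delta> (s + (x n - t))) (\<lambda>s. p (s + (x n - t))) \<gamma> \<tau> t)
        \<longlonglongrightarrow> lw_profile \<delta> p \<gamma> \<tau> t"
      by (rule tendsto_lw_profile[OF lw_contractive_translate[OF assms(1)] shift[OF assms(2)] shift[OF assms(3)]])
    then show "(\<lambda>n. lw_profile \<delta> p \<gamma> \<tau> (x n)) \<longlonglongrightarrow> lw_profile \<delta> p \<gamma> \<tau> t"
      by (simp add: lw_profile_translate)
  qed
  then show ?thesis
    by (simp add: continuous_on_eq_continuous_at)
qed

text \<open>Continuity of the profile makes the production continuous, so the convolution can be
  differentiated; the fixed-point equation then turns its linear equation into the delayed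
  one.\<close>

lemma lw_profile_solution:
  assumes "lw_contractive D a c P \<gamma> \<delta> p" "continuous_on UNIV \<delta>" "continuous_on UNIV p"
  shows "dde_solution (lasota_wazewska \<delta> p \<gamma>) \<tau> t0 (lw_profile \<delta> p \<gamma> \<tau>)"
  unfolding dde_solution_def
proof (intro conjI allI impI)
  let ?y = "lw_profile \<delta> p \<gamma> \<tau>"
  note cont = lw_profile_continuous[OF assms]
  show "continuous_on {t0 - \<tau>..} ?y"
    by (rule continuous_on_subset[OF cont]) simp
  fix t assume "t0 \<le> t"
  have "continuous_on UNIV (lw_production p \<gamma> \<tau> ?y)"
    unfolding lw_production_def
    by (intro continuous_intros assms(3) continuous_on_compose2[OF cont]) auto
  then have "(decay_conv \<delta> (lw_production p \<gamma> \<tau> ?y) has_real_derivative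
      - \<delta> t * decay_conv \<delta> (lw_production p \<gamma> \<tau> ?y) t + lw_production p \<gamma> \<tau> ?y t) (at t within {t0..})"
    by (rule decay_conv_has_derivative[OF lw_contractiveD(1)[OF assms(1)] assms(2) _
          lw_production_bounds(3)[OF assms(1) lw_profile_nonneg[OF assms(1)]] \<open>t0 \<le> t\<close>])
  moreover have "decay_conv \<delta> (lw_production p \<gamma> \<tau> ?y) = ?y"
    using lw_profile_fixed_point[OF assms(1)] by (intro ext) simp
  ultimately show "(?y has_real_derivative lasota_wazewska \<delta> p \<gamma> t (?y t) (?y (t - \<tau>))) (at t within {t0..})"
    by (simp add: lasota_wazewska_def lw_production_def)
qed

section \<open>Linear equations with delayed forcing\<close>

text \<open>The continuous counterpart of \<open>decaying\<close>, stated with the gauge integral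
  over forward intervals to suit the fundamental theorem of calculus.\<close>

locale exp_decay =
  fixes \<delta> :: "real \<Rightarrow> real" and a c :: real
  assumes cont: "continuous_on UNIV \<delta>" and a_pos: "0 < a"
    and decay: "s \<le> t \<Longrightarrow> a * (t - s) - c \<le> integral {s..t} \<delta>"
begin

lemma c_nonneg: "0 \<le> c"
  using decay[of 0 0] by simp

lemma exp_minus_integral_le:
  assumes "s \<le> t"
  shows "exp (- integral {s..t} \<delta>) \<le> exp (c - a * (t - s))"
  using decay[OF assms] by simp

text \<open>The factor integrates from \<open>t\<close> up to the fixed end \<open>T\<close>, so it
  equals 1 at \<open>T\<close> and is at most \<open>exp (c - a * (T - t))\<close> before.\<close>

lemma integrating_factor:
  assumes "t \<in> {t1..T}"
    and "(w has_real_derivative - \<delta> t * w t + h t) (at t within {t1..T})"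
  shows "((\<lambda>t. exp (- integral {t..T} \<delta>) * w t) has_real_derivative exp (- integral {t..T} \<delta>) * h t)
    (at t within {t1..T})"
proof -
  have "((\<lambda>t. integral {t..T} \<delta>) has_real_derivative - \<delta> t) (at t within {t1..T})"
    by (rule integral_has_real_derivative'[OF continuous_on_subset[OF cont] assms(1)]) auto
  then show ?thesis
    using assms(2) by (auto intro!: derivative_eq_intros simp: algebra_simps)
qed

lemma linear_ode_bound:
  assumes "t1 \<le> T"
    and "\<And>t. t \<in> {t1..T} \<Longrightarrow> (w has_real_derivative - \<delta> t * w t + h t) (at t within {t1..T})"
    and "\<And>t. t \<in> {t1..T} \<Longrightarrow> \<bar>h t\<bar> \<le> H"
  shows "\<bar>w T\<bar> \<le> exp (c - a * (T - t1)) * \<bar>w t1\<bar> + exp c / a * H"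
proof -
  let ?u = "\<lambda>t. exp (- integral {t..T} \<delta>) * w t"
  \<comment> \<open>An explicit antiderivative of the majorant
    \<open>exp (c - a * (T - t)) * H\<close>; its value at \<open>T\<close> is
    \<open>exp c / a * H\<close>.\<close>
  let ?v = "\<lambda>t. exp (c - a * (T - t)) / a * H"
  have "0 \<le> H"
    using assms(1) order_trans[OF abs_ge_zero assms(3)[of t1]] by simp
  have u: "(?u has_vector_derivative exp (- integral {t..T} \<delta>) * h t) (at t within {t1..T})"
    if "t \<in> {t1..T}" for t
    using integrating_factor[where w = w and h = h, OF that assms(2)[OF that]]
    by (simp add: has_real_derivative_iff_has_vector_derivative)
  have v: "(?v has_vector_derivative exp (c - a * (T - t)) * H) (at t within {t1..T})" for t
    using a_pos unfolding has_real_derivative_iff_has_vector_derivative[symmetric]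
    by (auto intro!: derivative_eq_intros)
  have I: "((\<lambda>t. exp (- integral {t..T} \<delta>) * h t) has_integral ?u T - ?u t1) {t1..T}"
    by (rule fundamental_theorem_of_calculus[OF assms(1) u])
  have J: "((\<lambda>t. exp (c - a * (T - t)) * H) has_integral ?v T - ?v t1) {t1..T}"
    by (rule fundamental_theorem_of_calculus[OF assms(1) v])
  have "\<bar>?u T - ?u t1\<bar> \<le> ?v T - ?v t1"
  proof -
    have "norm (integral {t1..T} (\<lambda>t. exp (- integral {t..T} \<delta>) * h t))
      \<le> integral {t1..T} (\<lambda>t. exp (c - a * (T - t)) * H)"
    proof (rule integral_norm_bound_integral)
      fix t assume t: "t \<in> {t1..T}"
      then show "norm (exp (- integral {t..T} \<delta>) * h t) \<le> exp (c - a * (T - t)) * H"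
        unfolding norm_mult using exp_minus_integral_le[of t T] assms(3)[OF t]
        by (intro mult_mono) auto
    qed (use I J in \<open>auto simp: integrable_on_def\<close>)
    then show ?thesis
      unfolding integral_unique[OF I] integral_unique[OF J] real_norm_def .
  qed
  also have "\<dots> \<le> exp c / a * H"
    using a_pos \<open>0 \<le> H\<close> by simp
  finally have "\<bar>w T - ?u t1\<bar> \<le> exp c / a * H"
    by simp
  moreover have "\<bar>?u t1\<bar> \<le> exp (c - a * (T - t1)) * \<bar>w t1\<bar>"
    unfolding abs_mult using exp_minus_integral_le[OF assms(1)] by (intro mult_right_mono) auto
  ultimately show ?thesis
    by linarith
qed

text \<open>Nonnegative forcing makes \<open>w\<close> times the integrating factor nondecreasing,
  so a negative initial value can only decay, up to the factor \<open>exp c\<close>.\<close>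

lemma linear_ode_lower_bound:
  assumes "t1 \<le> T"
    and "\<And>t. t \<in> {t1..T} \<Longrightarrow> (w has_real_derivative - \<delta> t * w t + h t) (at t within {t1..T})"
    and "\<And>t. t \<in> {t1..T} \<Longrightarrow> 0 \<le> h t"
    and "- m \<le> w t1" "0 \<le> m"
  shows "- (m * exp (c - a * (T - t1))) \<le> w T"
proof -
  let ?u = "\<lambda>t. exp (- integral {t..T} \<delta>) * w t"
  have u: "(?u has_vector_derivative exp (- integral {t..T} \<delta>) * h t) (at t within {t1..T})"
    if "t \<in> {t1..T}" for t
    using integrating_factor[where w = w and h = h, OF that assms(2)[OF that]]
    by (simp add: has_real_derivative_iff_has_vector_derivative)
  have "((\<lambda>t. exp (- integral {t..T} \<delta>) * h t) has_integral ?u T - ?u t1) {t1..T}"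
    by (rule fundamental_theorem_of_calculus[OF assms(1) u])
  then have "0 \<le> ?u T - ?u t1"
    by (rule has_integral_nonneg) (use assms(3) in auto)
  moreover have "exp (- integral {t1..T} \<delta>) * (- m) \<le> ?u t1"
    by (intro mult_left_mono assms(4)) auto
  moreover have "exp (- integral {t1..T} \<delta>) * m \<le> exp (c - a * (T - t1)) * m"
    by (intro mult_right_mono exp_minus_integral_le assms(1,5))
  ultimately show ?thesis
    by (simp add: mult.commute)
qed

lemma ode_derivative_Icc:
  fixes w :: "real \<Rightarrow> real"
  assumes "\<And>t. t0 \<le> t \<Longrightarrow> (w has_real_derivative - \<delta> t * w t + h t) (at t within {t0..})"
    and "t0 \<le> t1" "t \<in> {t1..T}"
  shows "(w has_real_derivative - \<delta> t * w t + h t) (at t within {t1..T})"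
  using assms(1)[of t] by (rule has_field_derivative_subset) (use assms(2,3) in auto)

text \<open>At a maximum point \<open>x\<close> of \<open>\<bar>w\<bar>\<close> on
  \<open>{t0 - \<tau>..T}\<close> the delayed term is controlled by \<open>\<bar>w x\<bar>\<close>
  itself. It contributes at most half of \<open>\<bar>w x\<bar>\<close>; absorbing that half
  produces the factor 2.\<close>

lemma delayed_ode_stable:
  assumes "continuous_on {t0 - \<tau>..} w" "0 < \<tau>"
    and w': "\<And>t. t0 \<le> t \<Longrightarrow> (w has_real_derivative - \<delta> t * w t + h t) (at t within {t0..})"
    and h: "\<And>t. t0 \<le> t \<Longrightarrow> \<bar>h t\<bar> \<le> L * \<bar>w (t - \<tau>)\<bar>"
    and L: "exp c / a * L \<le> 1/2" "0 \<le> L"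
    and init: "\<And>s. s \<in> {t0 - \<tau>..t0} \<Longrightarrow> \<bar>w s\<bar> \<le> \<eta>"
    and "t0 - \<tau> \<le> T"
  shows "\<bar>w T\<bar> \<le> 2 * exp c * \<eta>"
proof -
  have "continuous_on {t0 - \<tau>..T} (\<lambda>t. \<bar>w t\<bar>)"
    using continuous_on_subset[OF assms(1)] by (intro continuous_intros) auto
  then obtain x where x: "x \<in> {t0 - \<tau>..T}" "\<And>t. t \<in> {t0 - \<tau>..T} \<Longrightarrow> \<bar>w t\<bar> \<le> \<bar>w x\<bar>"
    using continuous_attains_sup[of "{t0 - \<tau>..T}" "\<lambda>t. \<bar>w t\<bar>"] assms(8) by fastforce
  have "0 \<le> \<eta>"
    using order_trans[OF abs_ge_zero init[of t0]] \<open>0 < \<tau>\<close> by simp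
  have "1 \<le> exp c"
    using c_nonneg by simp
  have "\<bar>w x\<bar> \<le> 2 * exp c * \<eta>"
  proof (cases "x \<le> t0")
    case True
    then have "\<bar>w x\<bar> \<le> 1 * \<eta>"
      using init x(1) by simp
    also have "\<dots> \<le> 2 * exp c * \<eta>"
      using \<open>0 \<le> \<eta>\<close> \<open>1 \<le> exp c\<close> by (intro mult_right_mono) linarith+
    finally show ?thesis .
  next
    case False
    have "\<bar>w x\<bar> \<le> exp (c - a * (x - t0)) * \<bar>w t0\<bar> + exp c / a * (L * \<bar>w x\<bar>)"
    proof (rule linear_ode_bound)
      fix t assume t: "t \<in> {t0..x}"
      show "(w has_real_derivative - \<delta> t * w t + h t) (at t within {t0..x})"
        by (rule ode_derivative_Icc[OF w' order_refl t])
      have "\<bar>h t\<bar> \<le> L * \<bar>w (t - \<tau>)\<bar>"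
        using h t by simp
      also have "\<dots> \<le> L * \<bar>w x\<bar>"
        using x t \<open>0 < \<tau>\<close> L(2) by (intro mult_left_mono) auto
      finally show "\<bar>h t\<bar> \<le> L * \<bar>w x\<bar>" .
    qed (use False in auto)
    also have "exp (c - a * (x - t0)) * \<bar>w t0\<bar> \<le> exp c * \<eta>"
      using a_pos False init[of t0] \<open>0 < \<tau>\<close> by (intro mult_mono) auto
    also have "exp c / a * (L * \<bar>w x\<bar>) \<le> 1/2 * \<bar>w x\<bar>"
      using mult_right_mono[OF L(1), of "\<bar>w x\<bar>"] by (simp add: mult.assoc)
    finally show ?thesis
      by simp
  qed
  then show ?thesis
    using x(2)[of T] assms(8) by force
qed

lemma delayed_ode_tendsto_0:
  assumes "continuous_on {t0 - \<tau>..} w" "0 < \<tau>"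
    and w': "\<And>t. t0 \<le> t \<Longrightarrow> (w has_real_derivative - \<delta> t * w t + h t) (at t within {t0..})"
    and h: "\<And>t. t0 \<le> t \<Longrightarrow> \<bar>h t\<bar> \<le> L * \<bar>w (t - \<tau>)\<bar>"
    and L: "exp c / a * L \<le> 1/2" "0 \<le> L"
  shows "(w \<longlongrightarrow> 0) at_top"
proof -
  have "bounded (w ` {t0 - \<tau>..t0})"
    using continuous_on_subset[OF assms(1), of "{t0 - \<tau>..t0}"]
    by (intro compact_imp_bounded compact_continuous_image) auto
  then obtain \<eta> where "\<forall>x\<in>w ` {t0 - \<tau>..t0}. norm x \<le> \<eta>"
    unfolding bounded_iff by blast
  then have "\<bar>w s\<bar> \<le> \<eta>" if "s \<in> {t0 - \<tau>..t0}" for s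
    using that by simp
  then have B: "\<bar>w T\<bar> \<le> 2 * exp c * \<eta>" if "t0 - \<tau> \<le> T" for T
    using delayed_ode_stable[OF assms] that by blast
  define B where "B = 2 * exp c * \<eta>"
  \<comment> \<open>The bound is demanded from \<open>t1 - \<tau>\<close> on, so that it covers the
    delayed argument of every \<open>t \<ge> t1\<close>. The ratio 3/4 is 1/4 for the fading value
    at \<open>t1\<close> plus 1/2 for the delayed forcing.\<close>
  have step: "\<exists>t1\<ge>t0. \<forall>t\<ge>t1 - \<tau>. \<bar>w t\<bar> \<le> B * (3/4) ^ n" for n
  proof (induction n)
    case 0
    then show ?case using B by (auto simp: B_def)
  next
    case (Suc n)
    then obtain t1 where t1: "t0 \<le> t1" "\<And>t. t1 - \<tau> \<le> t \<Longrightarrow> \<bar>w t\<bar> \<le> B * (3/4) ^ n"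
      by blast
    define M where "M = B * (3/4) ^ n"
    have "0 \<le> M"
      using order_trans[OF abs_ge_zero t1(2)[of t1]] \<open>0 < \<tau>\<close> by (simp add: M_def)
    \<comment> \<open>The waiting time after which the propagator bound
      \<open>exp (c - a * x)\<close> has dropped to 1/4.\<close>
    define x where "x = (c + ln 4) / a"
    have x: "0 \<le> x" "exp (c - a * x) = 1/4"
      using a_pos c_nonneg by (auto simp: x_def exp_minus)
    have "\<bar>w T\<bar> \<le> 3/4 * M" if T: "t1 + x \<le> T" for T
    proof -
      have "\<bar>w T\<bar> \<le> exp (c - a * (T - t1)) * \<bar>w t1\<bar> + exp c / a * (L * M)"
      proof (rule linear_ode_bound)
        fix t assume t: "t \<in> {t1..T}"
        show "(w has_real_derivative - \<delta> t * w t + h t) (at t within {t1..T})"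
          by (rule ode_derivative_Icc[OF w' t1(1) t])
        have "\<bar>h t\<bar> \<le> L * \<bar>w (t - \<tau>)\<bar>"
          using h t t1 by simp
        also have "\<dots> \<le> L * M"
          using t L(2) t1(2)[of "t - \<tau>"] by (intro mult_left_mono) (auto simp: M_def)
        finally show "\<bar>h t\<bar> \<le> L * M" .
      qed (use T x in auto)
      also have "exp (c - a * (T - t1)) * \<bar>w t1\<bar> \<le> exp (c - a * x) * M"
        using a_pos T t1(2)[of t1] \<open>0 < \<tau>\<close> by (intro mult_mono) (auto simp: M_def)
      also have "exp c / a * (L * M) \<le> 1/2 * M"
        using mult_right_mono[OF L(1) \<open>0 \<le> M\<close>] by (simp add: mult.assoc)
      finally show ?thesis
        by (simp add: x)
    qed
    \<comment> \<open>The new starting time is \<open>t1 + x + \<tau>\<close>, the extra \<tau>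
      compensating for the delay window in the claim.\<close>
    then show ?case
      using t1(1) x(1) \<open>0 < \<tau>\<close>
      by (intro exI[of _ "t1 + x + \<tau>"]) (auto simp: M_def mult_ac)
  qed
  have "(\<lambda>n. B * (3/4) ^ n) \<longlonglongrightarrow> B * 0"
    by (intro tendsto_intros LIMSEQ_power_zero) auto
  then have small: "\<exists>n. B * (3/4) ^ n < e" if "0 < e" for e
    using order_tendstoD(2)[of "\<lambda>n. B * (3/4) ^ n" 0 sequentially e] that
    by (auto simp: eventually_sequentially)
  show ?thesis
    unfolding tendsto_iff eventually_at_top_linorder dist_real_def
  proof (intro allI impI)
    fix e :: real assume "0 < e"
    then obtain n where "B * (3/4) ^ n < e"
      using small by blast
    then show "\<exists>N. \<forall>t\<ge>N. \<bar>w t - 0\<bar> < e"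
      using step[of n] by (metis diff_zero le_less_trans)
  qed
qed

end

section \<open>The Lasota-Wazewska model\<close>

lemma lw_profile_almost_automorphic:
  assumes "lw_contractive D a c P \<gamma> \<delta> p" "almost_automorphic \<delta>" "almost_automorphic p"
  shows "almost_automorphic (lw_profile \<delta> p \<gamma> \<tau>)"
  unfolding almost_automorphic_def
proof (intro conjI allI)
  show "continuous_on UNIV (lw_profile \<delta> p \<gamma> \<tau>)"
    using assms unfolding almost_automorphic_def by (intro lw_profile_continuous[OF assms(1)]) auto
  fix s :: "nat \<Rightarrow> real"
  obtain r \<delta>' p' where r: "strict_mono r"
    and \<delta>: "\<And>t. (\<lambda>n. \<delta> (t + s (r n))) \<longlonglongrightarrow> \<delta>' t" "\<And>t. (\<lambda>n. \<delta>' (t - s (r n))) \<longlonglongrightarrow> \<delta> t"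
    and p: "\<And>t. (\<lambda>n. p (t + s (r n))) \<longlonglongrightarrow> p' t" "\<And>t. (\<lambda>n. p' (t - s (r n))) \<longlonglongrightarrow> p t"
    using almost_automorphic_common_subseq[OF assms(2,3)] by metis
  note shifted = lw_contractive_translate[OF assms(1)]
  note limit = lw_contractive_lim[OF shifted \<delta>(1) p(1)]
  have "(\<lambda>n. lw_profile \<delta> p \<gamma> \<tau> (t + s (r n))) \<longlonglongrightarrow> lw_profile \<delta>' p' \<gamma> \<tau> t" for t
    using tendsto_lw_profile[OF shifted \<delta>(1) p(1)] by (simp add: lw_profile_translate)
  moreover have "(\<lambda>n. lw_profile \<delta>' p' \<gamma> \<tau> (t - s (r n))) \<longlonglongrightarrow> lw_profile \<delta> p \<gamma> \<tau> t" for t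
  \<comment> \<open>The limit coefficients may be discontinuous but lie in the class with the same
    constants, so continuous dependence applies again, with the opposite shifts.\<close>
  proof -
    have "(\<lambda>n. lw_profile (\<lambda>t. \<delta>' (t + - s (r n))) (\<lambda>t. p' (t + - s (r n))) \<gamma> \<tau> t)
        \<longlonglongrightarrow> lw_profile \<delta> p \<gamma> \<tau> t"
      by (rule tendsto_lw_profile[OF lw_contractive_translate[OF limit]]) (use \<delta>(2) p(2) in simp_all)
    then show ?thesis
      by (simp add: lw_profile_translate del: add_uminus_conv_diff) simp
  qed
  ultimately show "\<exists>r. strict_mono r \<and> (\<exists>\<psi>'. (\<forall>t. (\<lambda>n. lw_profile \<delta> p \<gamma> \<tau> (t + s (r n))) \<longlonglongrightarrow> \<psi>' t) \<and>
      (\<forall>t. (\<lambda>n. \<psi>' (t - s (r n))) \<longlonglongrightarrow> lw_profile \<delta> p \<gamma> \<tau> t))"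
    using r by blast
qed

text \<open>By uniformity in the centre, averages over all sufficiently long intervals exceed
  \<open>a\<close>. Short intervals are paid for by the constant \<open>c = 2 * a * T0\<close>,
  since the integral of \<delta> is nonnegative.\<close>

lemma exp_decay_if_mean_gt:
  assumes "ergodic \<delta>" "a < mean \<delta>" "0 < a" "\<And>t. 0 \<le> \<delta> t"
  obtains c where "exp_decay \<delta> a c"
proof -
  obtain m where m: "has_mean \<delta> m" and cont: "continuous_on UNIV \<delta>"
    using assms(1) unfolding ergodic_def by blast
  \<comment> \<open>Uniqueness of the limit is what gives the definite description in
    \<open>mean\<close> its intended value.\<close>
  have "m' = m" if "has_mean \<delta> m'" for m'
    using tendsto_unique[OF _ tendsto_uniform_limitI[OF that[unfolded has_mean_def], of 0]
        tendsto_uniform_limitI[OF m[unfolded has_mean_def], of 0]]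
    by simp
  then have "mean \<delta> = m"
    unfolding mean_def using m by blast
  then have "\<forall>\<^sub>F T in at_top. \<forall>\<xi>\<in>UNIV. dist (1 / (2 * T) * integral {- T + \<xi>..T + \<xi>} \<delta>) m < m - a"
    using assms(2) uniform_limitD[OF m[unfolded has_mean_def]] by simp
  then obtain T1 where T1: "\<And>T \<xi>. T1 \<le> T \<Longrightarrow> dist (1 / (2 * T) * integral {- T + \<xi>..T + \<xi>} \<delta>) m < m - a"
    unfolding eventually_at_top_linorder by blast
  define T0 where "T0 = max 1 T1"
  have nonneg: "0 \<le> integral {s..t} \<delta>" for s t
    by (rule integral_nonneg)
      (use assms(4) in \<open>auto intro!: integrable_continuous_real continuous_on_subset[OF cont]\<close>)
  have "a * (t - s) - 2 * a * T0 \<le> integral {s..t} \<delta>" if "s \<le> t" for s t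
  proof (cases "t - s < 2 * T0")
    case True
    then have "a * (t - s) \<le> a * (2 * T0)"
      using assms(3) by (intro mult_left_mono) auto
    then show ?thesis
      using nonneg[of s t] by simp
  next
    case False
    then have "1 \<le> T0" "T1 \<le> (t - s) / 2" "0 < t - s"
      by (auto simp: T0_def)
    \<comment> \<open>The interval from \<open>s\<close> to \<open>t\<close> is the averaging window
      with half-length \<open>(t - s) / 2\<close> centred at the midpoint.\<close>
    have "- ((t - s) / 2) + (s + t) / 2 = s" "(t - s) / 2 + (s + t) / 2 = t" "2 * ((t - s) / 2) = t - s"
      by (simp_all add: field_simps)
    then have "dist (1 / (t - s) * integral {s..t} \<delta>) m < m - a"
      using T1[OF \<open>T1 \<le> (t - s) / 2\<close>, of "(s + t) / 2"] by metis
    then have "a < 1 / (t - s) * integral {s..t} \<delta>"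
      unfolding dist_real_def by linarith
    then have "a * (t - s) \<le> integral {s..t} \<delta>"
      using \<open>0 < t - s\<close> by (simp add: field_simps)
    moreover have "0 \<le> 2 * a * T0"
      using assms(3) \<open>1 \<le> T0\<close> by simp
    ultimately show ?thesis
      by linarith
  qed
  then have "exp_decay \<delta> a (2 * a * T0)"
    by unfold_locales (use cont assms(3) in auto)
  then show ?thesis
    by (rule that)
qed

text \<open>The factor \<open>exp 1\<close> strengthens the smallness used for the fixed point: with
  \<open>\<gamma> \<le> 1\<close>, it bounds \<open>exp (- \<gamma> * v)\<close> for
  \<open>v \<ge> - 1\<close>, so differences of solutions bounded below by -1 contract as
  well.\<close>

locale lasota_wazewska_small = exp_decay +
  fixes D P \<gamma> \<tau> :: real and p :: "real \<Rightarrow> real"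
  assumes \<delta>_bounds: "0 \<le> \<delta> t" "\<delta> t \<le> D"
    and p_bounds: "0 \<le> p t" "p t \<le> P"
    and p_cont: "continuous_on UNIV p"
    and \<tau>_pos: "0 < \<tau>"
    and \<gamma>_bounds: "0 < \<gamma>" "\<gamma> \<le> 1"
    and small: "exp c / a * (P * (exp 1 * \<gamma>)) \<le> 1/2"
begin

abbreviation "F \<equiv> lasota_wazewska \<delta> p \<gamma>"
abbreviation "profile \<equiv> lw_profile \<delta> p \<gamma> \<tau>"

lemma P_nonneg: "0 \<le> P"
  using order_trans[OF p_bounds] .

lemma contractive: "lw_contractive D a c P \<gamma> \<delta> p"
proof -
  have "decaying D a c \<delta>"
    unfolding decaying_def reflected_interval_integral[OF cont]
    using a_pos \<delta>_bounds decay[of "t - r" t for t r] borel_measurable_continuous_onI[OF cont] by simp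
  moreover have "exp c / a * (P * \<gamma>) \<le> exp c / a * (P * (exp 1 * \<gamma>))"
    using a_pos P_nonneg \<gamma>_bounds by (intro mult_left_mono) auto
  ultimately show ?thesis
    unfolding lw_contractive_def
    using p_bounds \<gamma>_bounds less_imp_le order_trans[OF _ small]
      borel_measurable_continuous_onI[OF p_cont] by blast
qed

lemma profile_solution: "dde_solution F \<tau> t0 profile"
  by (rule lw_profile_solution[OF contractive cont p_cont])

lemma profile_nonneg: "0 \<le> profile t"
  by (rule lw_profile_nonneg[OF contractive])

lemma solution_derivative:
  assumes "dde_solution F \<tau> t0 z" "t0 \<le> t"
  shows "(z has_real_derivative - \<delta> t * z t + lw_production p \<gamma> \<tau> z t) (at t within {t0..})"
  using assms by (simp add: dde_solution_def lasota_wazewska_def lw_production_def)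

text \<open>The production is nonnegative whatever the sign of the solution, so the equation is
  linear with nonnegative forcing.\<close>

lemma solution_lower_bound:
  assumes "dde_solution F \<tau> t0 z" "- m \<le> z t0" "0 \<le> m" "t0 \<le> t"
  shows "- (m * exp (c - a * (t - t0))) \<le> z t"
proof (rule linear_ode_lower_bound[where h = "lw_production p \<gamma> \<tau> z"])
  fix s assume "s \<in> {t0..t}"
  then show "(z has_real_derivative - \<delta> s * z s + lw_production p \<gamma> \<tau> z s) (at s within {t0..t})"
    by (intro ode_derivative_Icc[where h = "lw_production p \<gamma> \<tau> z", OF solution_derivative[OF assms(1)] order_refl])
  show "0 \<le> lw_production p \<gamma> \<tau> z s"
    using p_bounds(1) by (simp add: lw_production_def)
qed (use assms in auto)

section \<open>Stability of the profile\<close>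

lemma difference_estimates:
  assumes "dde_solution F \<tau> t0 y" "dde_solution F \<tau> t0 z"
    and "\<And>t. t0 - \<tau> \<le> t \<Longrightarrow> - 1 \<le> y t" "\<And>t. t0 - \<tau> \<le> t \<Longrightarrow> - 1 \<le> z t"
  shows "continuous_on {t0 - \<tau>..} (\<lambda>t. z t - y t)"
    and "t0 \<le> t \<Longrightarrow> ((\<lambda>t. z t - y t) has_real_derivative
      - \<delta> t * (z t - y t) + (lw_production p \<gamma> \<tau> z t - lw_production p \<gamma> \<tau> y t)) (at t within {t0..})"
    and "t0 \<le> t \<Longrightarrow> \<bar>lw_production p \<gamma> \<tau> z t - lw_production p \<gamma> \<tau> y t\<bar>
      \<le> P * (exp 1 * \<gamma>) * \<bar>z (t - \<tau>) - y (t - \<tau>)\<bar>"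
proof -
  show "continuous_on {t0 - \<tau>..} (\<lambda>t. z t - y t)"
    using assms(1,2) by (intro continuous_on_diff) (auto simp: dde_solution_def)
next
  assume "t0 \<le> t"
  show "((\<lambda>t. z t - y t) has_real_derivative
      - \<delta> t * (z t - y t) + (lw_production p \<gamma> \<tau> z t - lw_production p \<gamma> \<tau> y t)) (at t within {t0..})"
    using DERIV_diff[OF solution_derivative[OF assms(2) \<open>t0 \<le> t\<close>] solution_derivative[OF assms(1) \<open>t0 \<le> t\<close>]]
    by (simp add: algebra_simps)
  have "\<bar>lw_production p \<gamma> \<tau> z t - lw_production p \<gamma> \<tau> y t\<bar>
      \<le> P * (exp (\<gamma> * 1) * \<gamma>) * \<bar>z (t - \<tau>) - y (t - \<tau>)\<bar>"
    by (rule abs_lw_production_diff_le) (use assms(3,4) \<open>t0 \<le> t\<close> p_bounds \<gamma>_bounds in auto)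
  also have "\<dots> \<le> P * (exp 1 * \<gamma>) * \<bar>z (t - \<tau>) - y (t - \<tau>)\<bar>"
    using P_nonneg \<gamma>_bounds by (intro mult_right_mono mult_left_mono) auto
  finally show "\<bar>lw_production p \<gamma> \<tau> z t - lw_production p \<gamma> \<tau> y t\<bar>
      \<le> P * (exp 1 * \<gamma>) * \<bar>z (t - \<tau>) - y (t - \<tau>)\<bar>" .
qed

lemma difference_stable:
  assumes "dde_solution F \<tau> t0 y" "dde_solution F \<tau> t0 z"
    and "\<And>t. t0 - \<tau> \<le> t \<Longrightarrow> - 1 \<le> y t" "\<And>t. t0 - \<tau> \<le> t \<Longrightarrow> - 1 \<le> z t"
    and "\<And>s. s \<in> {t0 - \<tau>..t0} \<Longrightarrow> \<bar>z s - y s\<bar> \<le> \<eta>" "t0 - \<tau> \<le> t"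
  shows "\<bar>z t - y t\<bar> \<le> 2 * exp c * \<eta>"
  by (rule delayed_ode_stable[OF difference_estimates(1)[OF assms(1-4)] \<tau>_pos
        difference_estimates(2,3)[OF assms(1-4)] small _ assms(5,6)])
    (use P_nonneg \<gamma>_bounds in auto)

lemma difference_tendsto_0:
  assumes "dde_solution F \<tau> t0 y" "dde_solution F \<tau> t0 z"
    and "\<And>t. t0 - \<tau> \<le> t \<Longrightarrow> - 1 \<le> y t" "\<And>t. t0 - \<tau> \<le> t \<Longrightarrow> - 1 \<le> z t"
  shows "((\<lambda>t. z t - y t) \<longlongrightarrow> 0) at_top"
  by (rule delayed_ode_tendsto_0[OF difference_estimates(1)[OF assms(1-4)] \<tau>_pos
        difference_estimates(2,3)[OF assms(1-4)] small])
    (use P_nonneg \<gamma>_bounds in auto)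

text \<open>The radius \<open>exp (- c)\<close> offsets the factor \<open>exp c\<close> by which a
  negative initial value may grow before it decays.\<close>

lemma nearby_solution_lower_bound:
  assumes "dde_solution F \<tau> t0 z" "\<And>s. s \<in> {t0 - \<tau>..t0} \<Longrightarrow> \<bar>z s - profile s\<bar> < exp (- c)"
    and "t0 - \<tau> \<le> t"
  shows "- 1 \<le> z t"
proof (cases "t \<le> t0")
  case True
  have "exp (- c) \<le> 1"
    using c_nonneg by simp
  then show ?thesis
    using assms(2)[of t] assms(3) True profile_nonneg[of t] unfolding atLeastAtMost_iff by linarith
next
  case False
  have "- exp (- c) \<le> z t0"
    using assms(2)[of t0] \<tau>_pos profile_nonneg[of t0] by auto
  then have "- (exp (- c) * exp (c - a * (t - t0))) \<le> z t"
    by (rule solution_lower_bound[OF assms(1)]) (use False in auto)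
  moreover have "exp (- c) * exp (c - a * (t - t0)) \<le> 1"
    using a_pos False by (simp flip: exp_add)
  ultimately show ?thesis
    by linarith
qed

lemma profile_asymptotically_stable: "dde_asymptotically_stable F \<tau> profile"
  unfolding dde_asymptotically_stable_def dde_stable_def dde_attractive_def
proof (intro conjI allI impI)
  have lower: "- 1 \<le> profile t" for t
    using profile_nonneg[of t] by simp
  show "\<exists>\<eta>>0. \<forall>z. dde_solution F \<tau> t0 z \<longrightarrow> (\<forall>s\<in>{t0 - \<tau>..t0}. \<bar>z s - profile s\<bar> < \<eta>) \<longrightarrow>
      ((\<lambda>t. z t - profile t) \<longlongrightarrow> 0) at_top" for t0
  proof (intro exI[of _ "exp (- c)"] conjI allI impI)
    fix z assume z: "dde_solution F \<tau> t0 z" "\<forall>s\<in>{t0 - \<tau>..t0}. \<bar>z s - profile s\<bar> < exp (- c)"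
    show "((\<lambda>t. z t - profile t) \<longlongrightarrow> 0) at_top"
      by (rule difference_tendsto_0[OF profile_solution z(1) lower nearby_solution_lower_bound[OF z(1)]])
        (use z(2) in auto)
  qed simp
  fix t0 \<epsilon> :: real assume "0 < \<epsilon>"
  \<comment> \<open>The first bound keeps \<open>z\<close> above -1; the second makes
    \<open>2 * exp c * \<eta>\<close> at most half of \<epsilon>.\<close>
  define \<eta> where "\<eta> = min (exp (- c)) (\<epsilon> / (4 * exp c))"
  have "0 < \<eta>"
    using \<open>0 < \<epsilon>\<close> by (simp add: \<eta>_def)
  have "2 * exp c * \<eta> \<le> 2 * exp c * (\<epsilon> / (4 * exp c))"
    by (intro mult_left_mono) (auto simp: \<eta>_def)
  then have \<eta>: "2 * exp c * \<eta> < \<epsilon>"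
    using \<open>0 < \<epsilon>\<close> by simp
  have "\<bar>z t - profile t\<bar> < \<epsilon>"
    if z: "dde_solution F \<tau> t0 z" "\<forall>s\<in>{t0 - \<tau>..t0}. \<bar>z s - profile s\<bar> < \<eta>" "t0 \<le> t" for z t
  proof -
    have "\<bar>z t - profile t\<bar> \<le> 2 * exp c * \<eta>"
    proof (rule difference_stable[OF profile_solution z(1) lower])
      show "- 1 \<le> z t" if "t0 - \<tau> \<le> t" for t
        by (rule nearby_solution_lower_bound[OF z(1) _ that]) (use z(2) in \<open>auto simp: \<eta>_def\<close>)
    qed (use z \<tau>_pos in \<open>auto simp: less_imp_le\<close>)
    then show ?thesis
      using \<eta> by linarith
  qed
  then show "\<exists>\<eta>>0. \<forall>z. dde_solution F \<tau> t0 z \<longrightarrow> (\<forall>s\<in>{t0 - \<tau>..t0}. \<bar>z s - profile s\<bar> < \<eta>) \<longrightarrow>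
      (\<forall>t\<ge>t0. \<bar>z t - profile t\<bar> < \<epsilon>)"
    using \<open>0 < \<eta>\<close> by blast
qed

text \<open>The lower bound \<open>- \<bar>z t0\<bar> * exp (c - a * (t - t0))\<close> tends to 0,
  and comparison with the zero function carries nonnegativity back to all times, including those
  where the equation is not imposed.\<close>

lemma almost_automorphic_solution_nonneg:
  assumes "almost_automorphic z" "dde_solution F \<tau> t0 z"
  shows "0 \<le> z t"
proof (rule almost_automorphic_le_if_asymptotically_le[OF almost_automorphic_zero assms(1)])
  fix e :: real assume "0 < e"
  have "filterlim (\<lambda>t. a * (- t0 + t)) at_top at_top"
    by (intro filterlim_tendsto_pos_mult_at_top[OF tendsto_const a_pos]
        filterlim_tendsto_add_at_top[OF tendsto_const] filterlim_ident)
  then have "((\<lambda>t. exp (- (a * (- t0 + t)))) \<longlongrightarrow> 0) at_top"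
    by (intro filterlim_compose[OF exp_at_bot] filterlim_compose[OF filterlim_uminus_at_bot_at_top])
  then have "((\<lambda>t. \<bar>z t0\<bar> * exp c * exp (- (a * (- t0 + t)))) \<longlongrightarrow> \<bar>z t0\<bar> * exp c * 0) at_top"
    by (rule tendsto_mult_left)
  moreover have "\<bar>z t0\<bar> * exp c * exp (- (a * (- t0 + t))) = \<bar>z t0\<bar> * exp (c - a * (t - t0))" for t
    by (simp add: right_diff_distrib mult.assoc flip: exp_add)
  ultimately have "((\<lambda>t. \<bar>z t0\<bar> * exp (c - a * (t - t0))) \<longlongrightarrow> 0) at_top"
    by (simp only: mult_zero_right)
  then have "\<forall>\<^sub>F t in at_top. \<bar>z t0\<bar> * exp (c - a * (t - t0)) < e"
    using order_tendstoD(2)[of "\<lambda>t. \<bar>z t0\<bar> * exp (c - a * (t - t0))" 0 at_top e] \<open>0 < e\<close> by simp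
  then show "\<forall>\<^sub>F t in at_top. 0 \<le> z t + e"
    using eventually_ge_at_top[of t0]
  proof eventually_elim
    case (elim t)
    have "- (\<bar>z t0\<bar> * exp (c - a * (t - t0))) \<le> z t"
      by (rule solution_lower_bound[OF assms(2)]) (use elim in auto)
    then show ?case
      using elim by linarith
  qed
qed

text \<open>Nonnegativity puts both solutions above -1, so their difference tends to 0; the
  comparison lemma, used in both directions, gives equality on the whole line.\<close>

lemma almost_automorphic_solution_unique:
  assumes "almost_automorphic y" "dde_solution F \<tau> t0 y" "almost_automorphic z" "dde_solution F \<tau> t0 z"
  shows "z = y"
proof
  have lower: "- 1 \<le> y t" "- 1 \<le> z t" for t
    using almost_automorphic_solution_nonneg[OF assms(1,2), of t]
      almost_automorphic_solution_nonneg[OF assms(3,4), of t] by auto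
  have "((\<lambda>t. z t - y t) \<longlongrightarrow> 0) at_top"
    by (rule difference_tendsto_0[OF assms(2,4) lower])
  then have close: "\<forall>\<^sub>F t in at_top. \<bar>z t - y t\<bar> < e" if "0 < e" for e
    using that by (simp add: tendsto_iff)
  fix t
  have "z t \<le> y t"
  proof (rule almost_automorphic_le_if_asymptotically_le[OF assms(3,1)])
    fix e :: real assume "0 < e"
    show "\<forall>\<^sub>F t in at_top. z t \<le> y t + e"
      using close[OF \<open>0 < e\<close>] by eventually_elim linarith
  qed
  moreover have "y t \<le> z t"
  proof (rule almost_automorphic_le_if_asymptotically_le[OF assms(1,3)])
    fix e :: real assume "0 < e"
    show "\<forall>\<^sub>F t in at_top. y t \<le> z t + e"
      using close[OF \<open>0 < e\<close>] by eventually_elim linarith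
  qed
  ultimately show "z t = y t"
    by simp
qed

end

theorem corollary4p2:
  fixes \<tau> \<delta>_minus :: real and \<delta> p :: "real \<Rightarrow> real"
  assumes "\<tau> > 0"
    and "almost_automorphic \<delta>" and "\<And>t. \<delta> t > 0"
    and "almost_automorphic p" and "\<And>t. p t > 0"
    and "ergodic \<delta>" and "mean \<delta> > \<delta>_minus" and "\<delta>_minus > 0"
  shows "\<exists>\<gamma>0>0. \<forall>\<gamma>. 0 < \<gamma> \<and> \<gamma> < \<gamma>0 \<longrightarrow>
    (\<exists>y. almost_automorphic y
       \<and> dde_solution (lasota_wazewska \<delta> p \<gamma>) \<tau> 0 y
       \<and> dde_asymptotically_stable (lasota_wazewska \<delta> p \<gamma>) \<tau> y
       \<and> (\<forall>z. almost_automorphic z \<and> dde_solution (lasota_wazewska \<delta> p \<gamma>) \<tau> 0 z \<longrightarrow> z = y))"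
proof -
  obtain c where c: "exp_decay \<delta> \<delta>_minus c"
    using exp_decay_if_mean_gt[OF assms(6-8) less_imp_le[OF assms(3)]] .
  obtain D where D: "\<And>t. \<bar>\<delta> t\<bar> \<le> D"
    using almost_automorphic_bounded[OF assms(2)] by blast
  obtain P where P: "\<And>t. \<bar>p t\<bar> \<le> P"
    using almost_automorphic_bounded[OF assms(4)] by blast
  have "0 < P"
    using assms(5)[of 0] P[of 0] by linarith
  \<comment> \<open>In terms of \<open>K\<close> the smallness condition reads
    \<open>K * \<gamma> \<le> 1/2\<close>, whence the threshold \<open>1 / (2 * K)\<close>; the
    minimum with 1 secures \<open>\<gamma> \<le> 1\<close>.\<close>
  define K where "K = exp c / \<delta>_minus * (P * exp 1)"
  have "0 < K"
    using \<open>0 < P\<close> assms(8) by (simp add: K_def)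
  show ?thesis
  proof (intro exI[of _ "min 1 (1 / (2 * K))"] conjI allI impI)
    show "0 < min 1 (1 / (2 * K))"
      using \<open>0 < K\<close> by simp
    fix \<gamma> assume \<gamma>: "0 < \<gamma> \<and> \<gamma> < min 1 (1 / (2 * K))"
    then have "K * \<gamma> \<le> 1/2"
      using \<open>0 < K\<close> by (simp add: field_simps)
    then have "exp c / \<delta>_minus * (P * (exp 1 * \<gamma>)) \<le> 1/2"
      by (simp add: K_def mult.assoc)
    moreover have "0 \<le> \<delta> t \<and> \<delta> t \<le> D" "0 \<le> p t \<and> p t \<le> P" for t
      using D[of t] P[of t] assms(3)[of t] assms(5)[of t] by auto
    moreover have "continuous_on UNIV p"
      using assms(4) by (simp add: almost_automorphic_def)
    ultimately interpret lasota_wazewska_small \<delta> \<delta>_minus c D P \<gamma> \<tau> p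
      using c \<gamma> assms(1) by (intro lasota_wazewska_small.intro lasota_wazewska_small_axioms.intro) auto
    have "almost_automorphic profile"
      by (rule lw_profile_almost_automorphic[OF contractive assms(2,4)])
    then show "\<exists>y. almost_automorphic y \<and> dde_solution F \<tau> 0 y \<and> dde_asymptotically_stable F \<tau> y
        \<and> (\<forall>z. almost_automorphic z \<and> dde_solution F \<tau> 0 z \<longrightarrow> z = y)"
      using profile_solution profile_asymptotically_stable almost_automorphic_solution_unique by blast
  qed
qed

end
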